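(* Let $p$ be a prime and $m,n,\ell$ positive integers. Let $k$ be a field of $\operatorname{char}(k)=p$ with $|k|\geq p^\ell$, let $F$ be a field containing $k$, and let $\pi$ be a sum of $\ell$ symbols in $\operatorname{H}^{n+1}_{p^m}(F)$. Then $\operatorname{ed}_{\operatorname{H}_{p^m}^{n+1}}(\pi)\leq m+\ell n$.
   Context: For a field $F$ of characteristic $p$ and positive integers $m,n$, the Kato-Milne cohomology group $\operatorname{H}_{p^m}^{n+1}(F)$ is the additive group $W_m(F)\otimes \underbrace{F^\times\otimes\dots\otimes F^\times}_{n\text{ times}}$ (tensor products over $\mathbb Z$) modulo the relations (i) $(\omega^p-\omega)\otimes b_1\otimes\dots\otimes b_n=0$; (ii) $(0,\dots,0,a,0,\dots,0)\otimes a\otimes b_2\otimes\dots\otimes b_n=0$ (with $a\in F^\times$ in any position); (iii) $\omega\otimes b_1\otimes\dots\otimes b_n=0$ whenever $b_i=b_j$ for some $i\neq j$. Here $W_m(F)$ is the ring of truncated $p$-typical Witt vectors of length $m$ over $F$, and for $\omega=(\omega_1,\dots,\omega_m)$, $\omega^p$ stands for $(\omega_1^p,\dots,\omega_m^p)$. The generators $\omega\otimes b_1\otimes\dots\otimes b_n$ are called ($p^m$-)symbols. $\operatorname{H}_{p^m}^{n+1}$ is regarded as a functor from fields containing $k$ to sets. The essential dimension $\operatorname{ed}_{\operatorname{H}_{p^m}^{n+1}}(\pi)$ of $\pi\in\operatorname{H}_{p^m}^{n+1}(F)$ is the minimal transcendence degree over $k$ of a field $E$ with $k\subseteq E\subseteq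 F$ for which there exists $\pi_0\in\operatorname{H}_{p^m}^{n+1}(E)$ with $\pi_0\otimes_E F=\pi$. *)

theory Defs
  imports
    "HOL-Algebra.Free_Abelian_Groups"
    "HOL-Algebra.Generated_Groups"
    "HOL-Algebra.Algebraic_Closure_Type"
    "HOL-Library.Extended_Nat"
begin

text \<open>
  All fields are subfields, in the sense of \<^const>\<open>subfield\<close>, of one ambient field given by
  a type of class \<open>field\<close> and regarded as the ring \<^term>\<open>ring_of_type_algebra\<close>; scalar
  extension is always along an inclusion.
\<close>

abbreviation ambient :: "'a::field ring"
  where "ambient \<equiv> ring_of_type_algebra"

text \<open>
  Polynomials with variables in \<open>'v\<close> and coefficients in \<open>'c\<close> are finitely supported functions
  from monomials to coefficients; \<open>h\<close> maps the coefficients to the target ring.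
\<close>

definition poly_eval :: "('c::zero \<Rightarrow> 'a::comm_ring_1) \<Rightarrow> ('v \<Rightarrow> 'a) \<Rightarrow> (('v \<Rightarrow>\<^sub>0 nat) \<Rightarrow>\<^sub>0 'c) \<Rightarrow> 'a"
  where "poly_eval h x P =
    (\<Sum>t\<in>Poly_Mapping.keys P. h (Poly_Mapping.lookup P t) *
       (\<Prod>v\<in>Poly_Mapping.keys t. x v ^ Poly_Mapping.lookup t v))"


subsection \<open>Truncated Witt vectors\<close>

text \<open>
  The variables \<open>X\<^sub>i\<close> and \<open>Y\<^sub>i\<close> are indexed by \<^term>\<open>Inl i\<close> and \<^term>\<open>Inr i\<close>.
  Components are numbered from 0.
\<close>

type_synonym witt_poly = "((nat + nat) \<Rightarrow>\<^sub>0 nat) \<Rightarrow>\<^sub>0 int"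

definition witt_var :: "nat + nat \<Rightarrow> witt_poly"
  where "witt_var v = Poly_Mapping.single (Poly_Mapping.single v 1) 1"

definition ghost :: "nat \<Rightarrow> nat \<Rightarrow> (nat \<Rightarrow> witt_poly) \<Rightarrow> witt_poly"
  where "ghost p n x = (\<Sum>i\<le>n. of_nat (p ^ i) * x i ^ (p ^ (n - i)))"

text \<open>
  By Witt's theorem, for prime \<open>p\<close> there is exactly one sequence of integer polynomials as in
  each of the following two definitions; its \<open>n\<close>-th member involves only variables of index
  at most \<open>n\<close>.
\<close>

definition witt_sum_poly :: "nat \<Rightarrow> nat \<Rightarrow> witt_poly"
  where "witt_sum_poly p = (THE S. \<forall>n. ghost p n S =
    ghost p n (\<lambda>i. witt_var (Inl i)) + ghost p n (\<lambda>i. witt_var (Inr i)))"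

definition witt_prod_poly :: "nat \<Rightarrow> nat \<Rightarrow> witt_poly"
  where "witt_prod_poly p = (THE S. \<forall>n. ghost p n S =
    ghost p n (\<lambda>i. witt_var (Inl i)) * ghost p n (\<lambda>i. witt_var (Inr i)))"

definition witt_op :: "nat \<Rightarrow> (nat \<Rightarrow> witt_poly) \<Rightarrow> 'a::comm_ring_1 list \<Rightarrow> 'a list \<Rightarrow> 'a list"
  where "witt_op m S xs ys = map (\<lambda>i. poly_eval of_int (case_sum ((!) xs) ((!) ys)) (S i)) [0..<m]"

definition witt_ring :: "nat \<Rightarrow> nat \<Rightarrow> 'a::field set \<Rightarrow> 'a list ring"
  where "witt_ring p m K =
    \<lparr>carrier = {xs. length xs = m \<and> set xs \<subseteq> K},
     monoid.mult = witt_op m (witt_prod_poly p),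
     one = map (\<lambda>i. if i = 0 then 1 else 0) [0..<m],
     zero = replicate m 0,
     add = witt_op m (witt_sum_poly p)\<rparr>"

definition witt_pow :: "nat \<Rightarrow> 'a::field list \<Rightarrow> 'a list"
  where "witt_pow p \<omega> = map (\<lambda>x. x ^ p) \<omega>"


subsection \<open>Tensor products over the integers\<close>

text \<open>
  \<open>G \<otimes> H \<otimes> \<dots> \<otimes> H\<close>, with \<open>n\<close> factors \<open>H\<close>, for commutative groups \<open>G\<close> and \<open>H\<close>, is the free
  abelian group on the tuples \<^term>\<open>(g, hs)\<close> modulo the multilinearity relations. The relations
  live in the additive group of \<^typ>\<open>'a \<Rightarrow>\<^sub>0 int\<close>, hence the minus signs.
\<close>

definition tensor_free :: "('g, 'x) monoid_scheme \<Rightarrow> ('h, 'y) monoid_scheme \<Rightarrow> nat \<Rightarrow>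
    ('g \<times> 'h list \<Rightarrow>\<^sub>0 int) monoid"
  where "tensor_free G H n =
    free_Abelian_group (carrier G \<times> {hs. length hs = n \<and> set hs \<subseteq> carrier H})"

definition multilinear_rels :: "('g, 'x) monoid_scheme \<Rightarrow> ('h, 'y) monoid_scheme \<Rightarrow> nat \<Rightarrow>
    ('g \<times> 'h list \<Rightarrow>\<^sub>0 int) set"
  where "multilinear_rels G H n =
    {frag_of (g \<otimes>\<^bsub>G\<^esub> g', hs) - frag_of (g, hs) - frag_of (g', hs) | g g' hs.
       g \<in> carrier G \<and> g' \<in> carrier G \<and> length hs = n \<and> set hs \<subseteq> carrier H} \<union>
    {frag_of (g, hs[i := h \<otimes>\<^bsub>H\<^esub> h']) - frag_of (g, hs[i := h]) - frag_of (g, hs[i := h']) | g hs i h h'.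
       g \<in> carrier G \<and> length hs = n \<and> set hs \<subseteq> carrier H \<and> i < n \<and>
       h \<in> carrier H \<and> h' \<in> carrier H}"

definition multilinear_subgroup :: "('g, 'x) monoid_scheme \<Rightarrow> ('h, 'y) monoid_scheme \<Rightarrow> nat \<Rightarrow>
    ('g \<times> 'h list \<Rightarrow>\<^sub>0 int) set"
  where "multilinear_subgroup G H n = generate (tensor_free G H n) (multilinear_rels G H n)"

definition tensor_group :: "('g, 'x) monoid_scheme \<Rightarrow> ('h, 'y) monoid_scheme \<Rightarrow> nat \<Rightarrow>
    ('g \<times> 'h list \<Rightarrow>\<^sub>0 int) set monoid"
  where "tensor_group G H n = tensor_free G H n Mod multilinear_subgroup G H n"

definition pure_tensor :: "('g, 'x) monoid_scheme \<Rightarrow> ('h, 'y) monoid_scheme \<Rightarrow> nat \<Rightarrow>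
    'g \<Rightarrow> 'h list \<Rightarrow> ('g \<times> 'h list \<Rightarrow>\<^sub>0 int) set"
  where "pure_tensor G H n g hs = multilinear_subgroup G H n #>\<^bsub>tensor_free G H n\<^esub> frag_of (g, hs)"


subsection \<open>Kato-Milne cohomology\<close>

definition witt_group :: "nat \<Rightarrow> nat \<Rightarrow> 'a::field set \<Rightarrow> 'a list monoid"
  where "witt_group p m K = add_monoid (witt_ring p m K)"

definition unit_group :: "'a::field set \<Rightarrow> 'a monoid"
  where "unit_group K = units_of (ambient\<lparr>carrier := K\<rparr>)"

abbreviation km_tensor_group :: "nat \<Rightarrow> nat \<Rightarrow> nat \<Rightarrow> 'a::field set \<Rightarrow>
    ('a list \<times> 'a list \<Rightarrow>\<^sub>0 int) set monoid"
  where "km_tensor_group p m n K \<equiv> tensor_group (witt_group p m K) (unit_group K) n"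

abbreviation km_tensor :: "nat \<Rightarrow> nat \<Rightarrow> nat \<Rightarrow> 'a::field set \<Rightarrow> 'a list \<Rightarrow> 'a list \<Rightarrow>
    ('a list \<times> 'a list \<Rightarrow>\<^sub>0 int) set"
  where "km_tensor p m n K \<omega> bs \<equiv> pure_tensor (witt_group p m K) (unit_group K) n \<omega> bs"

definition km_rels :: "nat \<Rightarrow> nat \<Rightarrow> nat \<Rightarrow> 'a::field set \<Rightarrow> ('a list \<times> 'a list \<Rightarrow>\<^sub>0 int) set set"
  where "km_rels p m n K =
    {km_tensor p m n K (witt_pow p \<omega> \<ominus>\<^bsub>witt_ring p m K\<^esub> \<omega>) bs | \<omega> bs.
       \<omega> \<in> carrier (witt_ring p m K) \<and> length bs = n \<and> set bs \<subseteq> carrier (unit_group K)} \<union>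
    {km_tensor p m n K ((replicate m 0)[i := a]) (a # bs) | i a bs.
       i < m \<and> a \<in> carrier (unit_group K) \<and> Suc (length bs) = n \<and> set bs \<subseteq> carrier (unit_group K)} \<union>
    {km_tensor p m n K \<omega> bs | \<omega> bs.
       \<omega> \<in> carrier (witt_ring p m K) \<and> length bs = n \<and> set bs \<subseteq> carrier (unit_group K) \<and>
       (\<exists>i j. i < n \<and> j < n \<and> i \<noteq> j \<and> bs ! i = bs ! j)}"

definition km_subgroup :: "nat \<Rightarrow> nat \<Rightarrow> nat \<Rightarrow> 'a::field set \<Rightarrow> ('a list \<times> 'a list \<Rightarrow>\<^sub>0 int) set set"
  where "km_subgroup p m n K = generate (km_tensor_group p m n K) (km_rels p m n K)"

text \<open>\<open>kato_milne p m n K\<close> is the group with \<open>n\<close> unit slots, i.e. of cohomological degree \<open>n + 1\<close>.\<close>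

definition kato_milne :: "nat \<Rightarrow> nat \<Rightarrow> nat \<Rightarrow> 'a::field set \<Rightarrow>
    ('a list \<times> 'a list \<Rightarrow>\<^sub>0 int) set set monoid"
  where "kato_milne p m n K = km_tensor_group p m n K Mod km_subgroup p m n K"

definition km_symbol :: "nat \<Rightarrow> nat \<Rightarrow> nat \<Rightarrow> 'a::field set \<Rightarrow> 'a list \<Rightarrow> 'a list \<Rightarrow>
    ('a list \<times> 'a list \<Rightarrow>\<^sub>0 int) set set"
  where "km_symbol p m n K \<omega> bs =
    km_subgroup p m n K #>\<^bsub>km_tensor_group p m n K\<^esub> km_tensor p m n K \<omega> bs"

definition km_symbols :: "nat \<Rightarrow> nat \<Rightarrow> nat \<Rightarrow> 'a::field set \<Rightarrow>
    ('a list \<times> 'a list \<Rightarrow>\<^sub>0 int) set set set"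
  where "km_symbols p m n K = {km_symbol p m n K \<omega> bs | \<omega> bs.
    \<omega> \<in> carrier (witt_ring p m K) \<and> length bs = n \<and> set bs \<subseteq> carrier (unit_group K)}"

text \<open>
  If \<open>f\<close> is a homomorphism from \<open>G'\<close> to \<open>G\<close> mapping the subgroup \<open>N'\<close> into \<open>N\<close>, then
  \<^term>\<open>coset_map G N f\<close> is the induced homomorphism from \<open>G' Mod N'\<close> to \<open>G Mod N\<close>: it sends the
  coset of \<open>x\<close> to the coset of \<open>f x\<close>.
\<close>

definition coset_map :: "('b, 'x) monoid_scheme \<Rightarrow> 'b set \<Rightarrow> ('a \<Rightarrow> 'b) \<Rightarrow> 'a set \<Rightarrow> 'b set"
  where "coset_map G N f C = N <#>\<^bsub>G\<^esub> (f ` C)"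

text \<open>
  Scalar extension to \<open>L\<close> of a class over a subfield \<open>E\<close> of \<open>L\<close>. On the free abelian groups it is
  the inclusion, that is, the identity on finitely supported functions, so that \<open>E\<close> need not be
  an argument.
\<close>

definition km_res :: "nat \<Rightarrow> nat \<Rightarrow> nat \<Rightarrow> 'a::field set \<Rightarrow>
    ('a list \<times> 'a list \<Rightarrow>\<^sub>0 int) set set \<Rightarrow> ('a list \<times> 'a list \<Rightarrow>\<^sub>0 int) set set"
  where "km_res p m n L =
    coset_map (km_tensor_group p m n L) (km_subgroup p m n L)
      (coset_map (tensor_free (witt_group p m L) (unit_group L) n)
         (multilinear_subgroup (witt_group p m L) (unit_group L) n) (\<lambda>c. c))"


subsection \<open>Transcendence degree and essential dimension\<close>

text \<open>The elements of \<open>B\<close> serve as the names of the variables.\<close>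

definition alg_independent :: "'a::field set \<Rightarrow> 'a set \<Rightarrow> bool"
  where "alg_independent k B \<longleftrightarrow>
    (\<forall>P :: ('a \<Rightarrow>\<^sub>0 nat) \<Rightarrow>\<^sub>0 'a.
       (\<forall>t\<in>Poly_Mapping.keys P. Poly_Mapping.lookup P t \<in> k \<and> Poly_Mapping.keys t \<subseteq> B) \<longrightarrow>
       poly_eval (\<lambda>c. c) (\<lambda>b. b) P = 0 \<longrightarrow> P = 0)"

definition trdeg :: "'a::field set \<Rightarrow> 'a set \<Rightarrow> enat"
  where "trdeg k E = (SUP B\<in>{B. finite B \<and> B \<subseteq> E \<and> alg_independent k B}. enat (card B))"

text \<open>
  \<open>T E\<close> is the value of the functor at \<open>E\<close>, and \<open>r\<close> the map from \<open>T E\<close> to \<open>T L\<close> for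
  \<open>E \<subseteq> L\<close>. The infimum is a minimum as soon as \<open>r\<close> is the identity on \<open>T L\<close>, since then
  \<open>E = L\<close> is admissible.
\<close>

definition essential_dimension ::
    "'a::field set \<Rightarrow> 'a set \<Rightarrow> ('a set \<Rightarrow> 'b set) \<Rightarrow> ('b \<Rightarrow> 'b) \<Rightarrow> 'b \<Rightarrow> enat"
  where "essential_dimension k L T r x =
    (INF E\<in>{E. subfield E ambient \<and> k \<subseteq> E \<and> E \<subseteq> L \<and> (\<exists>y\<in>T E. r y = x)}. trdeg k E)"

definition km_ed :: "nat \<Rightarrow> nat \<Rightarrow> nat \<Rightarrow> 'a::field set \<Rightarrow> 'a set \<Rightarrow>
    ('a list \<times> 'a list \<Rightarrow>\<^sub>0 int) set set \<Rightarrow> enat"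
  where "km_ed p m n k L = essential_dimension k L (\<lambda>E. carrier (kato_milne p m n E)) (km_res p m n L)"

end

theory Submission
  imports Defs
begin

text \<open>
  Choose \<open>v\<^sub>1, \<dots>, v\<^sub>l\<close> in \<open>k\<close> such that for all \<open>a\<^sub>1, \<dots>, a\<^sub>l\<close> in \<open>F\<close> there is a single \<open>c\<close> in
  \<open>F\<close> with \<open>a\<^sub>i - v\<^sub>i c\<close> of the form \<open>d\<^sup>p - d\<close> for all \<open>i\<close>; interpolation by additive polynomials
  provides them, and this is where \<open>p\<^sup>l\<close> elements of \<open>k\<close> are needed. Solving component by component
  lifts this to Witt vectors: up to elements \<open>x\<^sup>p - x\<close>, all Witt vectors \<open>\<omega>\<^sub>i\<close> in the \<open>l\<close> symbols are
  the products of the Teichmueller representatives of the \<open>v\<^sub>i\<close> with one common Witt vector \<open>\<theta>\<close>.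
  Hence the sum of the symbols is defined over the field generated over \<open>k\<close> by the \<open>m\<close> components of
  \<open>\<theta>\<close> and the \<open>l n\<close> units.
\<close>

subsection \<open>Evaluation of polynomials\<close>

text \<open>Multiplication by the Teichmueller representative of v multiplies component j of a Witt
  vector by v^(p^j). So the one-dimensional problem has to be solved with coefficients v_i^(p^j) for
  all j, the v_i being fixed beforehand. The common c comes from Frobenius: if a_i is the sum over t
  < l of M_t w_i^(p^t), then modulo elements d^p - d each summand may be replaced by its
  p^(l-1-t)-th power, in which w_i has exponent p^(l-1) whatever t is. Hence v_i = w_i^(p^(l-1))
  factors out, and the remaining sum of the M_t^(p^(l-1-t)) is independent of i. The w_i have to be
  linearly independent over the prime field; l such elements exist in k exactly when k has at least
  p^l elements. Solving by components is possible because component n of a Witt sum is x_n + y_n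
  plus an integer polynomial in earlier components. Witt addition is given by a definite
  description, so this is derived from ghost components over the integers. The v_i lie in k and cost
  nothing in the final count. Since the transcendence degree is a supremum over finite independent
  sets, each such set has to be bounded; this is done by counting monomials.\<close>

definition monomial_value :: "('v \<Rightarrow> 'a::comm_ring_1) \<Rightarrow> ('v \<Rightarrow>\<^sub>0 nat) \<Rightarrow> 'a"
  where "monomial_value x t = (\<Prod>v\<in>Poly_Mapping.keys t. x v ^ Poly_Mapping.lookup t v)"

lemma monomial_value_superset:
  assumes "finite S" "Poly_Mapping.keys t \<subseteq> S"
  shows "monomial_value x t = (\<Prod>v\<in>S. x v ^ Poly_Mapping.lookup t v)"
  unfolding monomial_value_def
  by (rule prod.mono_neutral_left) (use assms in \<open>auto simp: in_keys_iff\<close>)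

lemma monomial_value_add: "monomial_value x (s + t) = monomial_value x s * monomial_value x t"
proof -
  let ?S = "Poly_Mapping.keys s \<union> Poly_Mapping.keys t"
  have "monomial_value x (s + t) = (\<Prod>v\<in>?S. x v ^ Poly_Mapping.lookup (s + t) v)"
    by (rule monomial_value_superset) (auto simp: keys_add)
  also have "\<dots> = (\<Prod>v\<in>?S. x v ^ Poly_Mapping.lookup s v) * (\<Prod>v\<in>?S. x v ^ Poly_Mapping.lookup t v)"
    by (simp add: lookup_add power_add prod.distrib)
  also have "\<dots> = monomial_value x s * monomial_value x t"
    by (subst (1 2) monomial_value_superset[of ?S]) auto
  finally show ?thesis .
qed

lemma monomial_value_zero [simp]: "monomial_value x 0 = 1"
  by (simp add: monomial_value_def)

lemma poly_eval_monomial_value: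
  "poly_eval h x P = (\<Sum>t\<in>Poly_Mapping.keys P. h (Poly_Mapping.lookup P t) * monomial_value x t)"
  by (simp add: poly_eval_def monomial_value_def)

lemma poly_eval_superset:
  assumes "h 0 = 0" "finite S" "Poly_Mapping.keys P \<subseteq> S"
  shows "poly_eval h x P = (\<Sum>t\<in>S. h (Poly_Mapping.lookup P t) * monomial_value x t)"
  unfolding poly_eval_monomial_value
  by (rule sum.mono_neutral_left) (use assms in \<open>auto simp: in_keys_iff\<close>)

lemma poly_eval_single:
  assumes "h 0 = 0"
  shows "poly_eval h x (Poly_Mapping.single t c) = h c * monomial_value x t"
  by (subst poly_eval_superset[where S = "{t}"]) (use assms in auto)

lemma poly_eval_zero [simp]: "poly_eval h x 0 = 0"
  by (simp add: poly_eval_def)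

lemma poly_eval_add:
  assumes "h 0 = 0" "\<And>a b. h (a + b) = h a + h b"
  shows "poly_eval h x (P + Q) = poly_eval h x P + poly_eval h x Q"
proof -
  let ?S = "Poly_Mapping.keys P \<union> Poly_Mapping.keys Q"
  have "poly_eval h x (P + Q) = (\<Sum>t\<in>?S. h (Poly_Mapping.lookup (P + Q) t) * monomial_value x t)"
    by (rule poly_eval_superset) (use assms in \<open>auto simp: keys_add\<close>)
  also have "\<dots> = poly_eval h x P + poly_eval h x Q"
    by (subst (1 2) poly_eval_superset[of h ?S])
      (use assms in \<open>auto simp: lookup_add ring_distribs sum.distrib\<close>)
  finally show ?thesis .
qed

lemma poly_eval_sum:
  assumes "h 0 = 0" "\<And>a b. h (a + b) = h a + h b"
  shows "poly_eval h x (\<Sum>i\<in>I. P i) = (\<Sum>i\<in>I. poly_eval h x (P i))"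
  by (induction I rule: infinite_finite_induct) (auto simp: poly_eval_add assms)

lemma poly_mapping_eq_sum_single:
  "P = (\<Sum>t\<in>Poly_Mapping.keys P. Poly_Mapping.single t (Poly_Mapping.lookup P t))"
  by (rule poly_mapping_eqI)
    (auto simp: lookup_sum lookup_single when_def sum.delta' in_keys_iff)

lemma poly_eval_int_minus: "poly_eval of_int x (- P) = - poly_eval of_int x P"
  by (simp add: poly_eval_monomial_value sum_negf)

lemma poly_eval_int_add:
  "poly_eval of_int x (P + Q) = poly_eval of_int x P + poly_eval of_int x Q"
  by (rule poly_eval_add) auto

lemma poly_eval_int_diff:
  "poly_eval of_int x (P - Q) = poly_eval of_int x P - poly_eval of_int x Q"
  using poly_eval_int_add[of x P "- Q"] by (simp add: poly_eval_int_minus)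

lemma poly_eval_int_sum:
  "poly_eval of_int x (\<Sum>i\<in>I. P i) = (\<Sum>i\<in>I. poly_eval of_int x (P i))"
  by (rule poly_eval_sum) auto

lemma poly_eval_int_one [simp]: "poly_eval of_int x 1 = 1"
  by (simp add: poly_eval_def)

lemma poly_eval_int_mult:
  "poly_eval of_int x (P * Q) = poly_eval of_int x P * poly_eval of_int x Q"
proof -
  let ?s = "\<lambda>P t. Poly_Mapping.single t (Poly_Mapping.lookup P t)"
  have "P * Q = (\<Sum>s\<in>Poly_Mapping.keys P. \<Sum>t\<in>Poly_Mapping.keys Q. ?s P s * ?s Q t)"
    using arg_cong2[OF poly_mapping_eq_sum_single[of P] poly_mapping_eq_sum_single[of Q], of "(*)"]
    by (simp add: sum_product)
  then have "poly_eval of_int x (P * Q) =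
      (\<Sum>s\<in>Poly_Mapping.keys P. \<Sum>t\<in>Poly_Mapping.keys Q.
        (of_int (Poly_Mapping.lookup P s) * monomial_value x s) *
        (of_int (Poly_Mapping.lookup Q t) * monomial_value x t))"
    by (simp add: poly_eval_int_sum mult_single poly_eval_single monomial_value_add algebra_simps)
  then show ?thesis
    by (simp add: poly_eval_monomial_value sum_product)
qed

lemma poly_eval_int_power: "poly_eval of_int x (P ^ k) = poly_eval of_int x P ^ k"
  by (induction k) (auto simp: poly_eval_int_mult)

lemma poly_eval_int_of_nat [simp]: "poly_eval of_int x (of_nat k) = of_nat k"
  by (induction k) (auto simp: poly_eval_int_add)

text \<open>\<open>witt_var\<close> for an arbitrary type of variable names: identities between
  several Witt vectors need more than two families of variables.\<close>

definition pvar :: "'v \<Rightarrow> ('v \<Rightarrow>\<^sub>0 nat) \<Rightarrow>\<^sub>0 int"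
  where "pvar v = Poly_Mapping.single (Poly_Mapping.single v 1) 1"

lemma witt_var_eq_pvar: "witt_var = pvar"
  by (rule ext) (simp add: witt_var_def pvar_def)

lemma poly_eval_int_pvar [simp]: "poly_eval of_int x (pvar v) = x v"
  by (simp add: pvar_def poly_eval_single monomial_value_def)

text \<open>Taking an evaluation map for \<phi> composes substitutions; this carries identities of
  integer polynomials over to every commutative ring.\<close>

lemma ring_hom_poly_eval_int:
  fixes \<phi> :: "'r::comm_ring_1 \<Rightarrow> 's::comm_ring_1"
  assumes "\<And>a b. \<phi> (a + b) = \<phi> a + \<phi> b" "\<And>a b. \<phi> (a * b) = \<phi> a * \<phi> b" "\<phi> 1 = 1"
  shows "\<phi> (poly_eval of_int x P) = poly_eval of_int (\<lambda>v. \<phi> (x v)) P"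
proof -
  have zero: "\<phi> 0 = 0"
    using assms(1)[of 0 0] by simp
  have minus: "\<phi> (- a) = - \<phi> a" for a
    using assms(1)[of a "- a"] zero by (simp add: minus_unique)
  have nat: "\<phi> (of_nat k) = of_nat k" for k
    by (induction k) (auto simp: assms zero)
  have int: "\<phi> (of_int c) = of_int c" for c
    by (cases c rule: int_cases2) (auto simp: nat minus)
  have sum: "\<phi> (sum f I) = (\<Sum>i\<in>I. \<phi> (f i))" for f :: "_ \<Rightarrow> 'r" and I :: "('b \<Rightarrow>\<^sub>0 nat) set"
    by (induction I rule: infinite_finite_induct) (auto simp: assms zero)
  have power: "\<phi> (a ^ k) = \<phi> a ^ k" for a k
    by (induction k) (auto simp: assms)
  have prod: "\<phi> (prod f I) = (\<Prod>i\<in>I. \<phi> (f i))" for f :: "_ \<Rightarrow> 'r" and I :: "'b set"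
    by (induction I rule: infinite_finite_induct) (auto simp: assms)
  show ?thesis
    by (simp add: poly_eval_monomial_value sum assms int monomial_value_def prod power)
qed

lemma pvar_power: "pvar v ^ k = Poly_Mapping.single (Poly_Mapping.single v k) 1"
  by (induction k) (auto simp: pvar_def mult_single single_add[symmetric])

lemma monomial_value_pvar: "monomial_value pvar t = Poly_Mapping.single t 1"
proof -
  have "(\<Prod>v\<in>V. Poly_Mapping.single (g v) (1::int)) = Poly_Mapping.single (\<Sum>v\<in>V. g v) 1"
    for g :: "'a \<Rightarrow> 'a \<Rightarrow>\<^sub>0 nat" and V
    by (induction V rule: infinite_finite_induct) (auto simp: mult_single)
  then show ?thesis
    unfolding monomial_value_def pvar_power
    using poly_mapping_eq_sum_single[of t] by simp
qed

lemma of_int_poly_mapping: "(of_int c :: ('v \<Rightarrow>\<^sub>0 nat) \<Rightarrow>\<^sub>0 int) = Poly_Mapping.single 0 c"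
  by (metis of_int_eq_id id_apply single_of_int)

lemma poly_eval_pvar: "poly_eval of_int pvar P = P"
  by (simp add: poly_eval_monomial_value monomial_value_pvar of_int_poly_mapping mult_single
      flip: poly_mapping_eq_sum_single)

lemma poly_mapping_of_nat_mult_cancel:
  fixes P Q :: "('v \<Rightarrow>\<^sub>0 nat) \<Rightarrow>\<^sub>0 int"
  assumes "of_nat k * P = of_nat k * Q" "k \<noteq> 0"
  shows "P = Q"
proof (rule poly_mapping_eqI)
  fix t
  have lookup: "Poly_Mapping.lookup (of_nat k * R) t = int k * Poly_Mapping.lookup R t"
    for R :: "('v \<Rightarrow>\<^sub>0 nat) \<Rightarrow>\<^sub>0 int"
    by (induction k) (auto simp: lookup_add algebra_simps)
  show "Poly_Mapping.lookup P t = Poly_Mapping.lookup Q t"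
    using lookup[of P] lookup[of Q] assms by simp
qed


subsection \<open>Witt's theorem for addition\<close>

text \<open>\<open>ghost\<close> over an arbitrary commutative ring, in particular over polynomial
  rings in other variables.\<close>

definition ghost_component :: "nat \<Rightarrow> nat \<Rightarrow> (nat \<Rightarrow> 'r::comm_ring_1) \<Rightarrow> 'r"
  where "ghost_component p n x = (\<Sum>i\<le>n. of_nat (p ^ i) * x i ^ (p ^ (n - i)))"

lemma ghost_eq_ghost_component: "ghost = ghost_component"
  by (intro ext) (simp add: ghost_def ghost_component_def)

lemma ghost_component_lessThan:
  "ghost_component p n x = (\<Sum>i<n. of_nat (p ^ i) * x i ^ (p ^ (n - i))) + of_nat (p ^ n) * x n"
  by (simp add: ghost_component_def flip: lessThan_Suc_atMost)

lemma poly_eval_ghost_component: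
  "poly_eval of_int x (ghost_component p n f) = ghost_component p n (\<lambda>i. poly_eval of_int x (f i))"
  by (simp add: ghost_component_def poly_eval_int_sum poly_eval_int_mult poly_eval_int_power
      flip: of_nat_power)

text \<open>The n-th ghost component is p^n times the n-th entry plus terms in earlier entries, and
  p^n can be cancelled over the integers. Besides uniqueness in Witt's theorem, this yields the laws
  of Witt addition.\<close>

lemma ghost_component_inj:
  fixes x y :: "nat \<Rightarrow> ('v \<Rightarrow>\<^sub>0 nat) \<Rightarrow>\<^sub>0 int"
  assumes "p > 0" "\<And>n. ghost_component p n x = ghost_component p n y"
  shows "x = y"
proof
  fix n
  show "x n = y n"
  proof (induction n rule: less_induct)
    case (less n)
    have "of_nat (p ^ n) * x n = of_nat (p ^ n) * y n"
      using assms(2)[of n] less by (simp add: ghost_component_lessThan)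
    then show ?case
      by (rule poly_mapping_of_nat_mult_cancel) (use assms in auto)
  qed
qed

lemma prime_dvd_freshmans_dream:
  fixes p :: nat and a b :: "'r::comm_ring_1"
  assumes "Factorial_Ring.prime p"
  shows "of_nat p dvd (a + b) ^ p - a ^ p - b ^ p"
proof -
  have p: "p > 0" "p \<noteq> 0"
    using assms prime_gt_0_nat by auto
  have "(a + b) ^ p = (\<Sum>k\<le>p. of_nat (p choose k) * a ^ k * b ^ (p - k))"
    by (rule binomial_ring)
  also have "{..p} = insert 0 (insert p {0<..<p})"
    using p by auto
  finally have eq: "(a + b) ^ p - a ^ p - b ^ p =
      (\<Sum>k\<in>{0<..<p}. of_nat (p choose k) * a ^ k * b ^ (p - k))"
    using p by simp
  show ?thesis
    unfolding eq
  proof (rule dvd_sum)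
    fix k assume "k \<in> {0<..<p}"
    then have "p dvd (p choose k)"
      by (intro dvd_choose_prime) (use assms in auto)
    then have "of_nat p dvd (of_nat (p choose k) :: 'r)"
      by (auto elim!: dvdE)
    then show "of_nat p dvd of_nat (p choose k) * a ^ k * b ^ (p - k)"
      by (simp add: dvd_mult2)
  qed
qed

text \<open>Each further p-th power gains a factor p: A^p - B^p is A - B times a sum of p terms, all
  congruent to B^(p-1) modulo p, so that the sum is divisible by p.\<close>

lemma prime_power_dvd_power_diff:
  fixes a b :: "'r::comm_ring_1"
  assumes "of_nat p dvd a - b"
  shows "of_nat (p ^ Suc j) dvd a ^ (p ^ j) - b ^ (p ^ j)"
proof (induction j)
  case (Suc j)
  let ?A = "a ^ (p ^ j)" and ?B = "b ^ (p ^ j)"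
  have AB: "of_nat p dvd ?A - ?B"
    using Suc by (auto intro: dvd_mult_left)
  have "of_nat p dvd (\<Sum>i<p. ?B ^ (p - Suc i) * ?A ^ i)"
  proof -
    have "of_nat p dvd ?B ^ r * ?A ^ i - ?B ^ (r + i)" for r i
    proof -
      have "?A - ?B dvd ?A ^ i - ?B ^ i"
        by (simp add: power_diff_sumr2)
      then have "of_nat p dvd ?B ^ r * (?A ^ i - ?B ^ i)"
        using AB by (meson dvd_mult dvd_trans)
      then show ?thesis
        by (simp add: algebra_simps power_add)
    qed
    from this have "of_nat p dvd (\<Sum>i<p. ?B ^ (p - Suc i) * ?A ^ i - ?B ^ (p - Suc i + i))"
      by (intro dvd_sum)
    also have "(\<Sum>i<p. ?B ^ (p - Suc i) * ?A ^ i - ?B ^ (p - Suc i + i)) =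
        (\<Sum>i<p. ?B ^ (p - Suc i) * ?A ^ i) - of_nat p * ?B ^ (p - 1)"
      by (simp add: sum_subtractf)
    finally show ?thesis
      by (metis diff_add_cancel dvd_add dvd_triv_left)
  qed
  then have "of_nat (p ^ Suc j) * of_nat p dvd
      (?A - ?B) * (\<Sum>i<p. ?B ^ (p - Suc i) * ?A ^ i)"
    using Suc by (intro mult_dvd_mono) auto
  also have "(?A - ?B) * (\<Sum>i<p. ?B ^ (p - Suc i) * ?A ^ i) = ?A ^ p - ?B ^ p"
    by (rule power_diff_sumr2[symmetric])
  finally show ?case
    by (simp add: mult.commute flip: power_mult)
qed (use assms in simp)

text \<open>Raising all variables to the p-th power is an endomorphism that lifts Frobenius. The
  polynomials for which the congruence holds contain the variables and are closed under the ring
  operations, hence are all polynomials.\<close>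

lemma frobenius_lift:
  fixes P :: "('v \<Rightarrow>\<^sub>0 nat) \<Rightarrow>\<^sub>0 int"
  assumes p: "Factorial_Ring.prime p"
  shows "of_nat p dvd poly_eval of_int (\<lambda>v. pvar v ^ p) P - P ^ p"
proof -
  let ?\<phi> = "poly_eval of_int (\<lambda>v. pvar v ^ p) :: _ \<Rightarrow> ('v \<Rightarrow>\<^sub>0 nat) \<Rightarrow>\<^sub>0 int"
  define good where "good P \<longleftrightarrow> of_nat p dvd ?\<phi> P - P ^ p" for P
  have zero: "good 0" and one: "good 1"
    using prime_gt_0_nat[OF p] by (simp_all add: good_def power_0_left)
  have add: "good (P + Q)" if "good P" "good Q" for P Q
  proof -
    have "?\<phi> (P + Q) - (P + Q) ^ p =
        (?\<phi> P - P ^ p) + (?\<phi> Q - Q ^ p) - ((P + Q) ^ p - P ^ p - Q ^ p)"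
      by (simp add: poly_eval_int_add)
    then show ?thesis
      using that prime_dvd_freshmans_dream[OF p, of P Q] unfolding good_def
      by (metis dvd_add dvd_diff)
  qed
  \<comment> \<open>Differences are there to reach negative integer coefficients.\<close>
  have diff: "good (P - Q)" if "good P" "good Q" for P Q
  proof -
    have "?\<phi> (P - Q) - (P - Q) ^ p =
        (?\<phi> P - P ^ p) - (?\<phi> Q - Q ^ p) + ((P - Q + Q) ^ p - (P - Q) ^ p - Q ^ p)"
      by (simp add: poly_eval_int_diff)
    then show ?thesis
      using that prime_dvd_freshmans_dream[OF p, of "P - Q" Q] unfolding good_def
      by (metis dvd_add dvd_diff)
  qed
  have mult: "good (P * Q)" if "good P" "good Q" for P Q
  proof -
    have "?\<phi> (P * Q) - (P * Q) ^ p = (?\<phi> P - P ^ p) * ?\<phi> Q + P ^ p * (?\<phi> Q - Q ^ p)"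
      by (simp add: poly_eval_int_mult algebra_simps)
    then show ?thesis
      using that unfolding good_def by (metis dvd_add dvd_mult dvd_mult2)
  qed
  have var: "good (pvar v)" for v
    by (simp add: good_def)
  have pow: "good (pvar v ^ k)" for v k
    by (induction k) (auto intro: one mult var)
  have nat: "good (of_nat k)" for k
    by (induction k) (auto intro: zero one add)
  have int: "good (of_int c)" for c
    by (cases c rule: int_diff_cases) (simp add: diff nat)
  have prod: "good (\<Prod>v\<in>V. pvar v ^ e v)" for V e
    by (induction V rule: infinite_finite_induct) (auto intro: one mult pow)
  have sum: "good (\<Sum>t\<in>T. of_int (c t) * (\<Prod>v\<in>V t. pvar v ^ e t v))"
    for T :: "('v \<Rightarrow>\<^sub>0 nat) set" and c V e
    by (induction T rule: infinite_finite_induct) (auto intro: zero add mult int prod)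
  have "good (poly_eval of_int pvar P)"
    unfolding poly_eval_def by (rule sum)
  then show ?thesis
    by (simp add: poly_eval_pvar good_def)
qed

text \<open>Dwork's criterion for being a ghost vector.\<close>

lemma ghost_component_surj:
  fixes g :: "nat \<Rightarrow> ('v \<Rightarrow>\<^sub>0 nat) \<Rightarrow>\<^sub>0 int"
  assumes p: "Factorial_Ring.prime p"
    and g: "\<And>n. of_nat (p ^ Suc n) dvd poly_eval of_int (\<lambda>v. pvar v ^ p) (g n) - g (Suc n)"
  shows "\<exists>S. \<forall>n. ghost_component p n S = g n"
proof -
  let ?\<phi> = "poly_eval of_int (\<lambda>v. pvar v ^ p) :: _ \<Rightarrow> ('v \<Rightarrow>\<^sub>0 nat) \<Rightarrow>\<^sub>0 int"
  have "\<exists>S. \<forall>n. (\<Sum>i<n. of_nat (p ^ i) * S i ^ (p ^ (n - i))) + of_nat (p ^ n) * S n = g n"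
  proof (rule dependent_wellorder_choice)
    fix r :: "('v \<Rightarrow>\<^sub>0 nat) \<Rightarrow>\<^sub>0 int" and f h :: "nat \<Rightarrow> ('v \<Rightarrow>\<^sub>0 nat) \<Rightarrow>\<^sub>0 int" and n :: nat
    assume "\<And>y. y < n \<Longrightarrow> f y = h y"
    then show "((\<Sum>i<n. of_nat (p ^ i) * f i ^ (p ^ (n - i))) + of_nat (p ^ n) * r = g n) =
        ((\<Sum>i<n. of_nat (p ^ i) * h i ^ (p ^ (n - i))) + of_nat (p ^ n) * r = g n)"
      by simp
  next
    fix n and f :: "nat \<Rightarrow> ('v \<Rightarrow>\<^sub>0 nat) \<Rightarrow>\<^sub>0 int"
    assume IH: "\<And>i. i < n \<Longrightarrow>
      (\<Sum>j<i. of_nat (p ^ j) * f j ^ (p ^ (i - j))) + of_nat (p ^ i) * f i = g i"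
    show "\<exists>r. (\<Sum>i<n. of_nat (p ^ i) * f i ^ (p ^ (n - i))) + of_nat (p ^ n) * r = g n"
    proof (cases n)
      case 0
      then show ?thesis
        by (intro exI[of _ "g 0"]) simp
    next
      case (Suc k)
      have gk: "g k = ghost_component p k f"
        using IH[of k] Suc by (simp add: ghost_component_lessThan)
      \<comment> \<open>By \<open>frobenius_lift\<close>, \<open>?\<phi> (f i)\<close> is congruent
        to \<open>f i ^ p\<close> modulo p, so their p^(k-i)-th powers agree modulo p^(k-i+1), and
        the weight p^i raises this to p^n. Thus \<open>?\<phi> (g k)\<close> is congruent to the
        part of the n-th ghost component already fixed, while by hypothesis it is congruent to
        \<open>g n\<close>; the difference divided by p^n is the new entry.\<close>
      have "of_nat (p ^ n) dvd
          (\<Sum>i<n. of_nat (p ^ i) * ((?\<phi> (f i)) ^ (p ^ (k - i)) - f i ^ (p ^ (n - i))))"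
      proof (rule dvd_sum)
        fix i assume "i \<in> {..<n}"
        then have i: "i \<le> k"
          using Suc by simp
        have "of_nat (p ^ Suc (k - i)) dvd (?\<phi> (f i)) ^ (p ^ (k - i)) - (f i ^ p) ^ (p ^ (k - i))"
          by (rule prime_power_dvd_power_diff[OF frobenius_lift[OF p]])
        also have "(f i ^ p) ^ (p ^ (k - i)) = f i ^ (p ^ (n - i))"
          using i by (simp add: Suc Suc_diff_le flip: power_mult)
        finally have "of_nat (p ^ i) * of_nat (p ^ Suc (k - i)) dvd
            of_nat (p ^ i) * ((?\<phi> (f i)) ^ (p ^ (k - i)) - f i ^ (p ^ (n - i)))"
          by (rule mult_dvd_mono[OF dvd_refl])
        moreover have "p ^ n = p ^ i * p ^ Suc (k - i)"
          using i by (simp only: Suc flip: power_add) simp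
        ultimately show "of_nat (p ^ n) dvd
            of_nat (p ^ i) * ((?\<phi> (f i)) ^ (p ^ (k - i)) - f i ^ (p ^ (n - i)))"
          by (simp only: of_nat_mult)
      qed
      also have "(\<Sum>i<n. of_nat (p ^ i) * ((?\<phi> (f i)) ^ (p ^ (k - i)) - f i ^ (p ^ (n - i)))) =
          ?\<phi> (g k) - (\<Sum>i<n. of_nat (p ^ i) * f i ^ (p ^ (n - i)))"
        unfolding gk poly_eval_ghost_component
        by (simp add: ghost_component_def Suc sum_subtractf right_diff_distrib lessThan_Suc_atMost)
      finally have "of_nat (p ^ n) dvd ?\<phi> (g k) - (\<Sum>i<n. of_nat (p ^ i) * f i ^ (p ^ (n - i)))" .
      moreover have "a - s - (a - b) = b - s" for a b s :: "('v \<Rightarrow>\<^sub>0 nat) \<Rightarrow>\<^sub>0 int"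
        by simp
      ultimately
      have "of_nat (p ^ n) dvd g n - (\<Sum>i<n. of_nat (p ^ i) * f i ^ (p ^ (n - i)))"
        using dvd_diff[OF _ g[of k, folded Suc]] by (metis (no_types))
      then obtain r where r: "g n - (\<Sum>i<n. of_nat (p ^ i) * f i ^ (p ^ (n - i))) = of_nat (p ^ n) * r"
        by (rule dvdE)
      show ?thesis
        by (rule exI[of _ r]) (simp only: r[symmetric] add_diff_eq add_diff_cancel_left')
    qed
  qed
  then show ?thesis
    by (simp add: ghost_component_lessThan)
qed

text \<open>Nothing is known about the definite description \<open>witt_sum_poly\<close> before
  this: Dwork's criterion gives existence and \<open>ghost_component_inj\<close> uniqueness.\<close>

lemma witt_sum_poly_ghost:
  assumes p: "Factorial_Ring.prime p"
  shows "ghost p n (witt_sum_poly p) =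
    ghost p n (\<lambda>i. witt_var (Inl i)) + ghost p n (\<lambda>i. witt_var (Inr i))"
proof -
  let ?g = "\<lambda>n. ghost p n (\<lambda>i. witt_var (Inl i)) + ghost p n (\<lambda>i. witt_var (Inr i))"
  \<comment> \<open>For a sequence of variables, the Frobenius lift turns the n-th ghost component
    into the next one without its top term p^(n+1) X_(n+1).\<close>
  have var: "of_nat (p ^ Suc n) dvd
      poly_eval of_int (\<lambda>v. pvar v ^ p) (ghost_component p n (\<lambda>i. pvar (inc i)))
        - ghost_component p (Suc n) (\<lambda>i. pvar (inc i))"
    for n and inc :: "nat \<Rightarrow> nat + nat"
  proof -
    have "poly_eval of_int (\<lambda>v. pvar v ^ p) (ghost_component p n (\<lambda>i. pvar (inc i))) =
        (\<Sum>i<Suc n. of_nat (p ^ i) * pvar (inc i) ^ (p ^ (Suc n - i)))"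
      unfolding poly_eval_ghost_component unfolding ghost_component_def
      by (auto simp: lessThan_Suc_atMost Suc_diff_le power_mult intro!: sum.cong)
    then show ?thesis
      by (simp add: ghost_component_lessThan del: sum.lessThan_Suc)
  qed
  have "\<exists>S. \<forall>n. ghost_component p n S = ?g n"
  proof (rule ghost_component_surj[OF p])
    fix n
    show "of_nat (p ^ Suc n) dvd poly_eval of_int (\<lambda>v. pvar v ^ p) (?g n) - ?g (Suc n)"
      using dvd_add[OF var[of n Inl] var[of n Inr]]
      unfolding ghost_eq_ghost_component witt_var_eq_pvar poly_eval_int_add
      by (simp only: add_diff_add)
  qed
  then have "\<exists>!S. \<forall>n. ghost p n S = ?g n"
    unfolding ghost_eq_ghost_component
    by (intro ex_ex1I ghost_component_inj[OF prime_gt_0_nat[OF p]]) auto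
  from theI'[OF this] show ?thesis
    unfolding witt_sum_poly_def by blast
qed

subsection \<open>The group of Witt vectors\<close>

text \<open>Untruncated and over any commutative ring, so that it can also be applied to sequences
  of variables.\<close>

definition witt_add :: "nat \<Rightarrow> (nat \<Rightarrow> 'r::comm_ring_1) \<Rightarrow> (nat \<Rightarrow> 'r) \<Rightarrow> nat \<Rightarrow> 'r"
  where "witt_add p x y n = poly_eval of_int (case_sum x y) (witt_sum_poly p n)"

lemma ghost_component_witt_add:
  assumes "Factorial_Ring.prime p"
  shows "ghost_component p n (witt_add p x y) = ghost_component p n x + ghost_component p n y"
  using arg_cong[OF witt_sum_poly_ghost[OF assms, of n], of "poly_eval of_int (case_sum x y)"]
  by (simp add: ghost_eq_ghost_component poly_eval_int_add poly_eval_ghost_component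
      witt_var_eq_pvar witt_add_def[abs_def])

lemma ring_hom_witt_add:
  assumes "\<And>a b. \<phi> (a + b) = \<phi> a + \<phi> b" "\<And>a b. \<phi> (a * b) = \<phi> a * \<phi> b" "\<phi> 1 = 1"
  shows "\<phi> (witt_add p x y n) = witt_add p (\<lambda>i. \<phi> (x i)) (\<lambda>i. \<phi> (y i)) n"
proof -
  have "(\<lambda>v. \<phi> (case v of Inl i \<Rightarrow> x i | Inr i \<Rightarrow> y i)) = case_sum (\<lambda>i. \<phi> (x i)) (\<lambda>i. \<phi> (y i))"
    by (auto split: sum.splits)
  then show ?thesis
    unfolding witt_add_def by (subst ring_hom_poly_eval_int[of \<phi>]) (use assms in auto)
qed

lemma poly_eval_int_witt_add:
  "poly_eval of_int z (witt_add p x y n) =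
    witt_add p (\<lambda>i. poly_eval of_int z (x i)) (\<lambda>i. poly_eval of_int z (y i)) n"
  by (rule ring_hom_witt_add) (auto simp: poly_eval_int_add poly_eval_int_mult)

text \<open>The identity is proved for independent variables over the integers, where ghost
  components decide equality and turn Witt addition into ordinary addition, and is then specialised.
  Associativity and the zero law follow the same scheme.\<close>

lemma witt_add_commute:
  fixes x y :: "nat \<Rightarrow> 'r::comm_ring_1"
  assumes "Factorial_Ring.prime p"
  shows "witt_add p x y = witt_add p y x"
proof
  fix n
  let ?v = "\<lambda>(a :: bool) i :: nat. pvar (a, i)"
  have "witt_add p (?v False) (?v True) = witt_add p (?v True) (?v False)"
    by (rule ghost_component_inj[OF prime_gt_0_nat[OF assms]])
      (simp add: ghost_component_witt_add assms add.commute)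
  from arg_cong[OF fun_cong[OF this], of "poly_eval of_int (\<lambda>(a, i). if a then y i else x i)"]
  show "witt_add p x y n = witt_add p y x n"
    by (simp add: poly_eval_int_witt_add)
qed

lemma witt_add_assoc:
  fixes x y z :: "nat \<Rightarrow> 'r::comm_ring_1"
  assumes "Factorial_Ring.prime p"
  shows "witt_add p (witt_add p x y) z = witt_add p x (witt_add p y z)"
proof
  fix n
  let ?v = "\<lambda>(a :: bool option) i :: nat. pvar (a, i)"
  have "witt_add p (witt_add p (?v None) (?v (Some False))) (?v (Some True)) =
      witt_add p (?v None) (witt_add p (?v (Some False)) (?v (Some True)))"
    by (rule ghost_component_inj[OF prime_gt_0_nat[OF assms]])
      (simp add: ghost_component_witt_add assms add.assoc)
  from arg_cong[OF fun_cong[OF this], of "poly_eval of_int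
      (\<lambda>(a, i). case a of None \<Rightarrow> x i | Some b \<Rightarrow> if b then z i else y i)"]
  show "witt_add p (witt_add p x y) z n = witt_add p x (witt_add p y z) n"
    by (simp add: poly_eval_int_witt_add)
qed

lemma witt_add_zero:
  fixes x :: "nat \<Rightarrow> 'r::comm_ring_1"
  assumes "Factorial_Ring.prime p"
  shows "witt_add p (\<lambda>_. 0) x = x"
proof
  fix n
  have "p > 0"
    using assms prime_gt_0_nat by blast
  then have "ghost_component p n (\<lambda>_. 0 :: (nat \<Rightarrow>\<^sub>0 nat) \<Rightarrow>\<^sub>0 int) = 0" for n
    by (simp add: ghost_component_def power_0_left)
  then have "witt_add p (\<lambda>_. 0) pvar = (pvar :: nat \<Rightarrow> (nat \<Rightarrow>\<^sub>0 nat) \<Rightarrow>\<^sub>0 int)"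
    by (intro ghost_component_inj[OF \<open>p > 0\<close>]) (simp add: ghost_component_witt_add assms)
  from arg_cong[OF fun_cong[OF this], of "poly_eval of_int x"]
  show "witt_add p (\<lambda>_. 0) x n = x n"
    by (simp add: poly_eval_int_witt_add)
qed

section \<open>Carries: the triangular shape of Witt addition\<close>

definition witt_carry :: "nat \<Rightarrow> nat \<Rightarrow> witt_poly"
  where "witt_carry p n = witt_sum_poly p n - pvar (Inl n) - pvar (Inr n)"

definition truncate_seq :: "nat \<Rightarrow> (nat \<Rightarrow> 'r::zero) \<Rightarrow> nat \<Rightarrow> 'r"
  where "truncate_seq n x i = (if i < n then x i else 0)"

text \<open>Invariance under setting all variables of index at least n to 0 says that the n-th carry
  involves only variables of smaller index. By the ghost equation, p^n times the carry is an
  expression in the X_i, Y_i and sum polynomials S_i with i < n; induction covers the S_i, and p^n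
  is cancelled.\<close>

lemma witt_carry_lower:
  assumes p: "Factorial_Ring.prime p"
  shows "poly_eval of_int (case_sum (truncate_seq n (\<lambda>i. pvar (Inl i))) (truncate_seq n (\<lambda>i. pvar (Inr i))))
    (witt_carry p n) = witt_carry p n"
proof (induction n rule: less_induct)
  case (less n)
  let ?X = "\<lambda>i. pvar (Inl i) :: witt_poly" and ?Y = "\<lambda>i. pvar (Inr i) :: witt_poly"
  let ?\<tau> = "\<lambda>n. poly_eval of_int (case_sum (truncate_seq n ?X) (truncate_seq n ?Y))"
  let ?S = "witt_sum_poly p"
  have lower: "?\<tau> n (?S i) = ?S i" if "i < n" for i
  proof -
    \<comment> \<open>After truncation at the smaller index i, truncation at n changes nothing; this
      turns the induction hypothesis for i into invariance under \<open>?\<tau> n\<close>.\<close>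
    have "?\<tau> n (?\<tau> i P) = ?\<tau> i P" for P
    proof -
      have "(\<lambda>v. ?\<tau> n (case_sum (truncate_seq i ?X) (truncate_seq i ?Y) v)) =
          case_sum (truncate_seq i ?X) (truncate_seq i ?Y)"
        using that by (auto simp: truncate_seq_def split: sum.splits)
      then show ?thesis
        by (subst ring_hom_poly_eval_int[of "?\<tau> n"])
          (auto simp: poly_eval_int_add poly_eval_int_mult)
    qed
    then have "?\<tau> n (witt_carry p i) = witt_carry p i"
      using less[OF that] by metis
    moreover have "?S i = witt_carry p i + ?X i + ?Y i"
      by (simp add: witt_carry_def)
    ultimately show ?thesis
      using that by (simp add: poly_eval_int_add truncate_seq_def)
  qed
  have "(\<Sum>i<n. of_nat (p ^ i) * ?S i ^ (p ^ (n - i))) + of_nat (p ^ n) * ?S n =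
      (\<Sum>i<n. of_nat (p ^ i) * ?X i ^ (p ^ (n - i))) + of_nat (p ^ n) * ?X n +
      ((\<Sum>i<n. of_nat (p ^ i) * ?Y i ^ (p ^ (n - i))) + of_nat (p ^ n) * ?Y n)"
    using witt_sum_poly_ghost[OF p, of n]
    by (simp only: ghost_eq_ghost_component witt_var_eq_pvar ghost_component_lessThan)
  then have carry: "of_nat (p ^ n) * witt_carry p n =
      (\<Sum>i<n. of_nat (p ^ i) * ?X i ^ (p ^ (n - i))) + (\<Sum>i<n. of_nat (p ^ i) * ?Y i ^ (p ^ (n - i)))
      - (\<Sum>i<n. of_nat (p ^ i) * ?S i ^ (p ^ (n - i)))"
    by (simp add: witt_carry_def right_diff_distrib algebra_simps)
  have sum: "?\<tau> n (\<Sum>i<n. of_nat (p ^ i) * P i ^ (p ^ (n - i))) =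
      (\<Sum>i<n. of_nat (p ^ i) * P i ^ (p ^ (n - i)))" if "\<And>i. i < n \<Longrightarrow> ?\<tau> n (P i) = P i" for P
    by (simp add: poly_eval_int_sum poly_eval_int_mult poly_eval_int_power that
        del: of_nat_power flip: of_nat_power)
  have "?\<tau> n (of_nat (p ^ n) * witt_carry p n) = of_nat (p ^ n) * witt_carry p n"
    unfolding carry poly_eval_int_add poly_eval_int_diff
    by (intro arg_cong2[of _ _ _ _ "(+)"] arg_cong2[of _ _ _ _ "(-)"] sum)
      (auto simp: truncate_seq_def lower)
  then have "of_nat (p ^ n) * ?\<tau> n (witt_carry p n) = of_nat (p ^ n) * witt_carry p n"
    by (simp only: poly_eval_int_mult poly_eval_int_of_nat)
  then show ?case
    by (rule poly_mapping_of_nat_mult_cancel) (use prime_gt_0_nat[OF p] in auto)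
qed

text \<open>The last term sees only components before n. Equations between Witt vectors can
  therefore be solved recursively, each component being governed by ordinary addition.\<close>

lemma witt_add_carry:
  assumes p: "Factorial_Ring.prime p"
  shows "witt_add p x y n = x n + y n +
    poly_eval of_int (case_sum (truncate_seq n x) (truncate_seq n y)) (witt_carry p n)"
proof -
  let ?e = "poly_eval of_int (case_sum x y)"
  have "witt_add p x y n = x n + y n + ?e (witt_carry p n)"
    by (simp add: witt_carry_def poly_eval_int_diff witt_add_def)
  also have "?e (witt_carry p n) =
      poly_eval of_int (\<lambda>v. ?e (case_sum (truncate_seq n (\<lambda>i. pvar (Inl i)))
        (truncate_seq n (\<lambda>i. pvar (Inr i))) v)) (witt_carry p n)"
    by (subst witt_carry_lower[OF p, symmetric], rule ring_hom_poly_eval_int)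
      (auto simp: poly_eval_int_add poly_eval_int_mult)
  also have "(\<lambda>v. ?e (case_sum (truncate_seq n (\<lambda>i. pvar (Inl i))) (truncate_seq n (\<lambda>i. pvar (Inr i))) v)) =
      case_sum (truncate_seq n x) (truncate_seq n y)"
    by (auto simp: truncate_seq_def fun_eq_iff split: sum.splits)
  finally show ?thesis .
qed

text \<open>Needed for lists: \<open>(!) xs\<close> is unspecified beyond the length, which must not
  influence the first m components.\<close>

lemma witt_add_cong:
  assumes p: "Factorial_Ring.prime p"
    and "\<And>i. i \<le> n \<Longrightarrow> x i = x' i" "\<And>i. i \<le> n \<Longrightarrow> y i = y' i"
  shows "witt_add p x y n = witt_add p x' y' n"
proof -
  have "truncate_seq n x = truncate_seq n x'" "truncate_seq n y = truncate_seq n y'"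
    using assms by (auto simp: truncate_seq_def)
  then show ?thesis
    using assms by (simp add: witt_add_carry)
qed

lemma nth_witt_op_sum:
  "i < m \<Longrightarrow> witt_op m (witt_sum_poly p) xs ys ! i = witt_add p ((!) xs) ((!) ys) i"
  by (simp add: witt_op_def witt_add_def)

lemma length_witt_op [simp]: "length (witt_op m S xs ys) = m"
  by (simp add: witt_op_def)

section \<open>Subfields, and the group of truncated Witt vectors over them\<close>

context
  fixes K :: "'a::field set"
  assumes K: "subfield K ambient"
begin

lemma subfield_0 [intro]: "0 \<in> K" and subfield_1 [intro]: "1 \<in> K"
  and subfield_add [intro]: "a \<in> K \<Longrightarrow> b \<in> K \<Longrightarrow> a + b \<in> K"
  and subfield_mult [intro]: "a \<in> K \<Longrightarrow> b \<in> K \<Longrightarrow> a * b \<in> K"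
  and subfield_minus [intro]: "a \<in> K \<Longrightarrow> - a \<in> K"
  and subfield_inverse [intro]: "a \<in> K \<Longrightarrow> inverse a \<in> K"
proof -
  interpret R: field "ambient :: 'a ring"
    by (rule field_from_type_algebra)
  note ring_simps = ring_of_type_algebra_def
  have sub: "subring K ambient"
    using subfieldE(1)[OF K] .
  show zero: "0 \<in> K" "1 \<in> K" "a \<in> K \<Longrightarrow> b \<in> K \<Longrightarrow> a + b \<in> K" "a \<in> K \<Longrightarrow> b \<in> K \<Longrightarrow> a * b \<in> K"
    using subringE(2,3,6,7)[OF sub] by (auto simp: ring_simps)
  have "\<ominus>\<^bsub>ambient\<^esub> a = - a"
    by (rule R.minus_equality) (auto simp: ring_simps)
  then show "a \<in> K \<Longrightarrow> - a \<in> K"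
    using subringE(5)[OF sub, of a] by simp
  show "a \<in> K \<Longrightarrow> inverse a \<in> K"
  proof (cases "a = 0")
    case False
    assume "a \<in> K"
    have "inv\<^bsub>ambient\<^esub> a = inverse a"
      by (rule R.comm_inv_char) (use False in \<open>auto simp: ring_simps\<close>)
    then show ?thesis
      using R.subfield_m_inv(1)[OF K, of a] \<open>a \<in> K\<close> False by (auto simp: ring_simps)
  qed (use zero in simp)
qed

lemma subfield_diff [intro]: "a \<in> K \<Longrightarrow> b \<in> K \<Longrightarrow> a - b \<in> K"
  using subfield_add[OF _ subfield_minus, of a b] by simp

lemma subfield_divide [intro]: "a \<in> K \<Longrightarrow> b \<in> K \<Longrightarrow> a / b \<in> K"
  by (auto simp: divide_inverse)

lemma subfield_power [intro]: "a \<in> K \<Longrightarrow> a ^ n \<in> K"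
  by (induction n) auto

lemma subfield_sum: "(\<And>i. i \<in> I \<Longrightarrow> f i \<in> K) \<Longrightarrow> sum f I \<in> K"
  by (induction I rule: infinite_finite_induct) auto

lemma subfield_prod: "(\<And>i. i \<in> I \<Longrightarrow> f i \<in> K) \<Longrightarrow> prod f I \<in> K"
  by (induction I rule: infinite_finite_induct) auto

lemma subfield_of_nat: "of_nat n \<in> K"
  by (induction n) auto

lemma subfield_of_int: "of_int c \<in> K"
  by (cases c rule: int_diff_cases) (auto simp: subfield_of_nat)

lemma subfield_poly_eval_int: "(\<And>v. x v \<in> K) \<Longrightarrow> poly_eval of_int x P \<in> K"
  unfolding poly_eval_def
  by (intro subfield_sum subfield_mult subfield_prod subfield_of_int subfield_power) auto

lemma subfield_witt_carry:
  "(\<And>i. i < n \<Longrightarrow> x i \<in> K) \<Longrightarrow> (\<And>i. i < n \<Longrightarrow> y i \<in> K) \<Longrightarrow>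
    poly_eval of_int (case_sum (truncate_seq n x) (truncate_seq n y)) (witt_carry p n) \<in> K"
  by (rule subfield_poly_eval_int) (auto simp: truncate_seq_def split: sum.splits)

lemma subfield_witt_add:
  assumes "Factorial_Ring.prime p" "\<And>i. i \<le> n \<Longrightarrow> x i \<in> K" "\<And>i. i \<le> n \<Longrightarrow> y i \<in> K"
  shows "witt_add p x y n \<in> K"
  unfolding witt_add_carry[OF assms(1)]
  by (intro subfield_add subfield_witt_carry) (use assms in auto)

text \<open>Each component of the inverse is forced by the earlier ones. Componentwise negation
  would not do: for p = 2 it is not the negative in the Witt group.\<close>

lemma witt_neg_exists:
  assumes p: "Factorial_Ring.prime p" and x: "\<And>i. i < m \<Longrightarrow> x i \<in> K"
  shows "\<exists>y. \<forall>i<m. y i \<in> K \<and> witt_add p x y i = 0"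
proof -
  let ?c = "\<lambda>y i. poly_eval of_int (case_sum (truncate_seq i x) (truncate_seq i y)) (witt_carry p i)"
  have "\<exists>y. \<forall>i. i < m \<longrightarrow> y i \<in> K \<and> x i + y i + ?c y i = 0"
  proof (rule dependent_wellorder_choice)
    fix r :: 'a and f g :: "nat \<Rightarrow> 'a" and i
    assume "\<And>j. j < i \<Longrightarrow> f j = g j"
    then have "truncate_seq i f = truncate_seq i g"
      by (auto simp: truncate_seq_def)
    then show "(i < m \<longrightarrow> r \<in> K \<and> x i + r + ?c f i = 0) = (i < m \<longrightarrow> r \<in> K \<and> x i + r + ?c g i = 0)"
      by simp
  next
    fix i and f :: "nat \<Rightarrow> 'a"
    assume IH: "\<And>j. j < i \<Longrightarrow> j < m \<longrightarrow> f j \<in> K \<and> x j + f j + ?c f j = 0"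
    show "\<exists>r. i < m \<longrightarrow> r \<in> K \<and> x i + r + ?c f i = 0"
    proof (intro exI[of _ "- (x i + ?c f i)"] impI conjI)
      assume "i < m"
      then show "- (x i + ?c f i) \<in> K"
        by (intro subfield_minus subfield_add subfield_witt_carry) (use x IH in auto)
    qed simp
  qed
  then show ?thesis
    by (simp add: witt_add_carry[OF p])
qed

lemma witt_group_simps [simp]:
  "carrier (witt_group p m K) = {xs. length xs = m \<and> set xs \<subseteq> K}"
  "monoid.mult (witt_group p m K) = witt_op m (witt_sum_poly p)"
  "one (witt_group p m K) = replicate m 0"
  by (simp_all add: witt_group_def witt_ring_def)

lemma comm_group_witt_group:
  assumes p: "Factorial_Ring.prime p"
  shows "comm_group (witt_group p m K)"
proof (rule comm_groupI)
  show "x \<otimes>\<^bsub>witt_group p m K\<^esub> y \<in> carrier (witt_group p m K)"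
    if "x \<in> carrier (witt_group p m K)" "y \<in> carrier (witt_group p m K)" for x y
  proof -
    have nth: "x ! i \<in> K" "y ! i \<in> K" if "i < m" for i
      using that \<open>x \<in> _\<close> \<open>y \<in> _\<close> nth_mem[of i x] nth_mem[of i y] by auto
    have "witt_add p ((!) x) ((!) y) i \<in> K" if "i < m" for i
      by (rule subfield_witt_add[OF p]) (use that nth in auto)
    then show ?thesis
      by (auto simp: in_set_conv_nth nth_witt_op_sum)
  qed
  show "\<one>\<^bsub>witt_group p m K\<^esub> \<in> carrier (witt_group p m K)"
    by auto
  show "x \<otimes>\<^bsub>witt_group p m K\<^esub> y \<otimes>\<^bsub>witt_group p m K\<^esub> z = x \<otimes>\<^bsub>witt_group p m K\<^esub> (y \<otimes>\<^bsub>witt_group p m K\<^esub> z)"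
    for x y z
  proof (rule nth_equalityI)
    fix i assume "i < length (x \<otimes>\<^bsub>witt_group p m K\<^esub> y \<otimes>\<^bsub>witt_group p m K\<^esub> z)"
    then have i: "i < m"
      by simp
    have "witt_add p ((!) (witt_op m (witt_sum_poly p) x y)) ((!) z) i =
        witt_add p (witt_add p ((!) x) ((!) y)) ((!) z) i"
      by (rule witt_add_cong[OF p]) (use i in \<open>auto simp: nth_witt_op_sum\<close>)
    also have "\<dots> = witt_add p ((!) x) (witt_add p ((!) y) ((!) z)) i"
      by (simp add: witt_add_assoc[OF p])
    also have "\<dots> = witt_add p ((!) x) ((!) (witt_op m (witt_sum_poly p) y z)) i"
      by (rule witt_add_cong[OF p]) (use i in \<open>auto simp: nth_witt_op_sum\<close>)
    finally show "(x \<otimes>\<^bsub>witt_group p m K\<^esub> y \<otimes>\<^bsub>witt_group p m K\<^esub> z) ! i =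
        (x \<otimes>\<^bsub>witt_group p m K\<^esub> (y \<otimes>\<^bsub>witt_group p m K\<^esub> z)) ! i"
      using i by (simp add: nth_witt_op_sum)
  qed simp
  show "x \<otimes>\<^bsub>witt_group p m K\<^esub> y = y \<otimes>\<^bsub>witt_group p m K\<^esub> x" for x y
    by (rule nth_equalityI) (auto simp: nth_witt_op_sum witt_add_commute[OF p, of "(!) x"])
  show "\<one>\<^bsub>witt_group p m K\<^esub> \<otimes>\<^bsub>witt_group p m K\<^esub> x = x" if x: "x \<in> carrier (witt_group p m K)" for x
  proof (rule nth_equalityI)
    fix i assume "i < length (\<one>\<^bsub>witt_group p m K\<^esub> \<otimes>\<^bsub>witt_group p m K\<^esub> x)"
    then have i: "i < m"
      by simp
    have "witt_add p ((!) (replicate m 0)) ((!) x) i = witt_add p (\<lambda>_. 0) ((!) x) i"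
      by (rule witt_add_cong[OF p]) (use i in auto)
    then show "(\<one>\<^bsub>witt_group p m K\<^esub> \<otimes>\<^bsub>witt_group p m K\<^esub> x) ! i = x ! i"
      using i by (simp add: nth_witt_op_sum witt_add_zero[OF p])
  qed (use x in simp)
  show "\<exists>y\<in>carrier (witt_group p m K). y \<otimes>\<^bsub>witt_group p m K\<^esub> x = \<one>\<^bsub>witt_group p m K\<^esub>"
    if x: "x \<in> carrier (witt_group p m K)" for x
  proof -
    obtain y where y: "\<And>i. i < m \<Longrightarrow> y i \<in> K \<and> witt_add p ((!) x) y i = 0"
      using witt_neg_exists[OF p, of m "(!) x"] x by (auto simp: subset_iff)
    have "witt_op m (witt_sum_poly p) (map y [0..<m]) x = replicate m 0"
    proof (rule nth_equalityI)
      fix i assume "i < length (witt_op m (witt_sum_poly p) (map y [0..<m]) x)"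
      then have i: "i < m"
        by simp
      have "witt_add p ((!) (map y [0..<m])) ((!) x) i = witt_add p y ((!) x) i"
        by (rule witt_add_cong[OF p]) (use i in auto)
      then show "witt_op m (witt_sum_poly p) (map y [0..<m]) x ! i = replicate m 0 ! i"
        using i y by (simp add: nth_witt_op_sum witt_add_commute[OF p, of y])
    qed simp
    then show ?thesis
      by (intro bexI[of _ "map y [0..<m]"]) (use y in auto)
  qed
qed

end

subsection \<open>Simultaneous Artin--Schreier reduction\<close>

text \<open>Newton interpolation by additive polynomials. The polynomial \<open>N\<close> is monic
  of degree p^l and vanishes at the nodes chosen so far; as k has more than p^l elements, some c in
  k is not a root and serves as the next node. A multiple of \<open>N\<close> then corrects the
  value at c without disturbing the old nodes.\<close>

lemma additive_interpolation:
  fixes k F :: "'a::field set"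
  assumes p: "Factorial_Ring.prime p" "CHAR('a) = p"
    and F: "subfield F ambient" and kF: "k \<subseteq> F"
    and card: "infinite k \<or> p ^ l \<le> card k"
  shows "\<exists>w. (\<forall>i<l. w i \<in> k) \<and> (\<forall>a. (\<forall>i<l. a i \<in> F) \<longrightarrow>
    (\<exists>M. (\<forall>t<l. M t \<in> F) \<and> (\<forall>i<l. (\<Sum>t<l. M t * w i ^ (p ^ t)) = a i)))"
  using card
proof (induction l)
  case (Suc l)
  note field_intros = subfield_0[OF F] subfield_add[OF F] subfield_mult[OF F] subfield_power[OF F]
    subfield_diff[OF F] subfield_divide[OF F] subfield_minus[OF F] subfield_sum[OF F] subfield_1[OF F]
  have p1: "p > 1"
    using p prime_gt_1_nat by auto
  have "infinite k \<or> p ^ l \<le> card k"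
    using Suc.prems p1 by (metis Suc_n_not_le_n less_imp_le_nat nle_le order_trans power_increasing)
  from Suc.IH[OF this] obtain w where w: "\<And>i. i < l \<Longrightarrow> w i \<in> k"
    and interpol: "\<And>a. (\<And>i. i < l \<Longrightarrow> a i \<in> F) \<Longrightarrow>
      \<exists>M. (\<forall>t<l. M t \<in> F) \<and> (\<forall>i<l. (\<Sum>t<l. M t * w i ^ (p ^ t)) = a i)"
    by auto
  \<comment> \<open>Interpolating these values gives the lower coefficients \<mu> that make
    \<open>N\<close> vanish at every \<open>w i\<close>.\<close>
  have "- (w i ^ (p ^ l)) \<in> F" if "i < l" for i
    by (intro field_intros) (use w[OF that] kF in auto)
  from interpol[of "\<lambda>i. - (w i ^ (p ^ l))", OF this] obtain \<mu> where \<mu>: "\<And>t. t < l \<Longrightarrow> \<mu> t \<in> F"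
    and \<mu>_eq: "\<And>i. i < l \<Longrightarrow> (\<Sum>t<l. \<mu> t * w i ^ (p ^ t)) = - (w i ^ (p ^ l))"
    by auto
  define N where "N x = x ^ (p ^ l) + (\<Sum>t<l. \<mu> t * x ^ (p ^ t))" for x
  define q where "q = Polynomial.monom 1 (p ^ l) + (\<Sum>t<l. Polynomial.monom (\<mu> t) (p ^ t))"
  have poly_q: "poly q x = N x" for x
    by (simp add: q_def N_def poly_sum poly_monom)
  have lt: "p ^ t < p ^ l" if "t < l" for t
    using that p1 by (simp add: power_strict_increasing)
  have "poly.coeff q (p ^ l) = 1"
    using lt[THEN less_imp_neq] by (simp add: q_def coeff_sum)
  then have q0: "q \<noteq> 0"
    by auto
  have "Polynomial.degree q \<le> p ^ l"
    unfolding q_def using lt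
    by (intro degree_add_le degree_sum_le) (auto intro: order_trans[OF degree_monom_le] less_imp_le)
  then have roots: "card {x. poly q x = 0} \<le> p ^ l"
    using card_poly_roots_bound[OF q0] by linarith
  have "\<exists>c\<in>k. N c \<noteq> 0"
  proof (rule ccontr)
    assume "\<not> ?thesis"
    then have sub: "k \<subseteq> {x. poly q x = 0}"
      by (auto simp: poly_q)
    then have "finite k" "card k \<le> p ^ l"
      using poly_roots_finite[OF q0] card_mono[OF _ sub] roots
      by (auto dest: finite_subset)
    moreover have "p ^ l < p ^ Suc l"
      using p1 by simp
    ultimately show False
      using Suc.prems by linarith
  qed
  then obtain c where c: "c \<in> k" "N c \<noteq> 0"
    by blast
  have "N c \<in> F"
    using c kF \<mu> unfolding N_def by (intro field_intros) auto
  let ?w = "w(l := c)"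
  show ?case
  proof (rule exI[of _ ?w], intro conjI allI impI)
    fix a :: "nat \<Rightarrow> 'a" assume a: "\<forall>i<Suc l. a i \<in> F"
    then obtain M where M: "\<And>t. t < l \<Longrightarrow> M t \<in> F"
      and M_eq: "\<And>i. i < l \<Longrightarrow> (\<Sum>t<l. M t * w i ^ (p ^ t)) = a i"
      using interpol[of a] by auto
    \<comment> \<open>The multiple of \<open>N\<close> that repairs the value at the new node; its
      leading coefficient is the new coefficient with index l.\<close>
    define s where "s = (a l - (\<Sum>t<l. M t * c ^ (p ^ t))) / N c"
    have s: "s \<in> F"
      unfolding s_def using c kF M a \<open>N c \<in> F\<close> by (intro field_intros) auto
    define M' where "M' t = (if t < l then M t + s * \<mu> t else s)" for t
    have sum: "(\<Sum>t<Suc l. M' t * x ^ (p ^ t)) = (\<Sum>t<l. M t * x ^ (p ^ t)) + s * N x" for x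
      by (simp add: M'_def N_def ring_distribs sum.distrib sum_distrib_left mult.assoc)
    have N0: "N (w i) = 0" if "i < l" for i
      using \<mu>_eq[OF that] by (simp add: N_def)
    show "\<exists>M. (\<forall>t<Suc l. M t \<in> F) \<and> (\<forall>i<Suc l. (\<Sum>t<Suc l. M t * ?w i ^ (p ^ t)) = a i)"
    proof (intro exI[of _ M'] conjI allI impI)
      show "M' t \<in> F" for t
        unfolding M'_def using M \<mu> s by (auto intro!: field_intros)
      show "(\<Sum>t<Suc l. M' t * ?w i ^ (p ^ t)) = a i" if "i < Suc l" for i
        unfolding sum using that M_eq N0 c by (auto simp: s_def less_Suc_eq)
    qed
  qed (use w c in \<open>auto simp: less_Suc_eq\<close>)
qed simp

text \<open>The p-th power of the sum shifts it by one place, so the difference telescopes. Modulo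
  elements d^p - d, an element may thus be replaced by any of its Frobenius powers.\<close>

lemma artin_schreier_power:
  fixes y :: "'a::field"
  assumes "Factorial_Ring.prime p" "CHAR('a) = p"
  shows "y ^ (p ^ s) = y + (\<Sum>j<s. y ^ (p ^ j)) ^ p - (\<Sum>j<s. y ^ (p ^ j))"
proof -
  have "(\<Sum>j<s. y ^ (p ^ j)) ^ p = (\<Sum>j<s. y ^ (p ^ Suc j))"
    using assms by (simp add: freshmans_dream_sum mult.commute flip: power_mult)
  then have "(\<Sum>j<s. y ^ (p ^ j)) ^ p - (\<Sum>j<s. y ^ (p ^ j)) = y ^ (p ^ s) - y"
    using sum_lessThan_telescope[of "\<lambda>j. y ^ (p ^ j)" s] by (simp only: sum_subtractf) simp
  then show ?thesis
    by (simp add: algebra_simps)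
qed

text \<open>
  Each \<^term>\<open>v i\<close> is a \<open>p\<close>-power of degree high enough for the Frobenius-twisted terms of \<open>c\<close> to be
  untwisted, modulo elements \<^term>\<open>d ^ p - d\<close>, into the interpolating additive polynomial.
\<close>

lemma simultaneous_artin_schreier:
  fixes k F :: "'a::field set"
  assumes p: "Factorial_Ring.prime p" "CHAR('a) = p"
    and F: "subfield F ambient" and k: "subfield k ambient" and kF: "k \<subseteq> F"
    and card: "infinite k \<or> p ^ l \<le> card k"
  shows "\<exists>v. (\<forall>i<l. v i \<in> k) \<and> (\<forall>n a. (\<forall>i<l. a i \<in> F) \<longrightarrow>
    (\<exists>c\<in>F. \<exists>d. \<forall>i<l. d i \<in> F \<and> v i ^ (p ^ n) * c = a i + d i ^ p - d i))"
proof -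
  note field_intros = subfield_0[OF F] subfield_add[OF F] subfield_mult[OF F] subfield_power[OF F]
    subfield_sum[OF F]
  obtain w where w: "\<And>i. i < l \<Longrightarrow> w i \<in> k"
    and interpol: "\<And>a. (\<And>i. i < l \<Longrightarrow> a i \<in> F) \<Longrightarrow>
      \<exists>M. (\<forall>t<l. M t \<in> F) \<and> (\<forall>i<l. (\<Sum>t<l. M t * w i ^ (p ^ t)) = a i)"
    using additive_interpolation[OF p F kF card] by auto
  \<comment> \<open>The largest exponent in the interpolating polynomial is p^(l-1), so every term
    can be raised by Frobenius until \<open>w i\<close> occurs with just this power.\<close>
  define v where "v i = w i ^ (p ^ (l - 1))" for i
  have "\<exists>c\<in>F. \<exists>d. \<forall>i<l. d i \<in> F \<and> v i ^ (p ^ n) * c = a i + d i ^ p - d i"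
    if a: "\<And>i. i < l \<Longrightarrow> a i \<in> F" for n a
  proof (induction n)
    case 0
    obtain M where M: "\<And>t. t < l \<Longrightarrow> M t \<in> F"
      and M_eq: "\<And>i. i < l \<Longrightarrow> (\<Sum>t<l. M t * w i ^ (p ^ t)) = a i"
      using interpol[of a] a by auto
    define y where "y i t = M t * w i ^ (p ^ t)" for i t
    define D where "D i t = (\<Sum>j<l - 1 - t. y i t ^ (p ^ j))" for i t
    \<comment> \<open>What remains of the terms \<open>y i t ^ (p ^ (l - 1 - t))\<close> once
      \<open>v i\<close> is factored out; it no longer depends on i.\<close>
    define c where "c = (\<Sum>t<l. M t ^ (p ^ (l - 1 - t)))"
    have y: "y i t \<in> F" if "i < l" "t < l" for i t
      unfolding y_def by (intro field_intros) (use that M w kF in auto)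
    show ?case
    proof (intro bexI[of _ c] exI[of _ "\<lambda>i. \<Sum>t<l. D i t"] allI impI conjI)
      fix i assume i: "i < l"
      show "(\<Sum>t<l. D i t) \<in> F"
        unfolding D_def by (intro field_intros) (use i y in auto)
      have "v i * c = (\<Sum>t<l. y i t ^ (p ^ (l - 1 - t)))"
        unfolding c_def sum_distrib_left
      proof (rule sum.cong)
        fix t assume "t \<in> {..<l}"
        then have "p ^ (l - 1) = p ^ t * p ^ (l - 1 - t)"
          by (simp flip: power_add)
        then show "v i * M t ^ (p ^ (l - 1 - t)) = y i t ^ (p ^ (l - 1 - t))"
          by (simp add: v_def y_def power_mult_distrib mult.commute flip: power_mult)
      qed simp
      also have "\<dots> = (\<Sum>t<l. y i t + D i t ^ p - D i t)"
        unfolding D_def by (intro sum.cong refl artin_schreier_power p)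
      also have "\<dots> = a i + (\<Sum>t<l. D i t) ^ p - (\<Sum>t<l. D i t)"
        using M_eq[OF i] by (simp add: y_def sum.distrib sum_subtractf freshmans_dream_sum p)
      finally show "v i ^ (p ^ 0) * c = a i + (\<Sum>t<l. D i t) ^ p - (\<Sum>t<l. D i t)"
        by simp
    qed (use M in \<open>auto simp: c_def intro!: field_intros\<close>)
  next
    case (Suc n)
    then obtain c d where c: "c \<in> F" and d: "\<And>i. i < l \<Longrightarrow> d i \<in> F"
      and eq: "\<And>i. i < l \<Longrightarrow> v i ^ (p ^ n) * c = a i + d i ^ p - d i"
      by blast
    show ?case
    \<comment> \<open>The old value u = \<open>v i ^ (p ^ n) * c\<close> becomes u^p = u + (u^p -
      u). So u has to be added to the old witness \<open>d i\<close>, and u + \<open>d i\<close> is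
      \<open>d i ^ p + a i\<close>.\<close>
    proof (intro bexI[of _ "c ^ p"] exI[of _ "\<lambda>i. d i ^ p + a i"] allI impI conjI)
      fix i assume i: "i < l"
      show "d i ^ p + a i \<in> F"
        by (intro field_intros d a i)
      have "v i ^ (p ^ Suc n) * c ^ p + d i ^ p = (v i ^ (p ^ n) * c + d i) ^ p"
        by (simp add: freshmans_dream p power_mult_distrib mult.commute flip: power_mult)
      also have "v i ^ (p ^ n) * c + d i = d i ^ p + a i"
        by (simp add: eq[OF i])
      finally show "v i ^ (p ^ Suc n) * c ^ p = a i + (d i ^ p + a i) ^ p - (d i ^ p + a i)"
        by (simp add: algebra_simps)
    qed (use c in \<open>auto intro: field_intros\<close>)
  qed
  moreover have "v i \<in> k" if "i < l" for i
    unfolding v_def using w[OF that] subfield_power[OF k] by blast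
  ultimately show ?thesis
    by blast
qed

text \<open>The entries \<open>v i ^ (p ^ j) * \<theta> j\<close> are those of the Teichmueller
  representative of \<open>v i\<close> times \<theta>. Congruence modulo x^p - x is written with a
  sum on both sides, so that no Witt subtraction has to be unfolded. All x_i and \<theta> are built
  in one recursion, since the common \<theta> enters the carries for every i.\<close>

lemma simultaneous_witt_reduction:
  fixes k F :: "'a::field set"
  assumes p: "Factorial_Ring.prime p" "CHAR('a) = p"
    and F: "subfield F ambient" and k: "subfield k ambient" and kF: "k \<subseteq> F"
    and card: "infinite k \<or> p ^ l \<le> card k"
    and \<omega>: "\<And>i j. i < l \<Longrightarrow> j < m \<Longrightarrow> \<omega> i j \<in> F"
  shows "\<exists>v \<theta> x. (\<forall>i<l. v i \<in> k) \<and> (\<forall>j<m. \<theta> j \<in> F) \<and> (\<forall>i<l. \<forall>j<m. x i j \<in> F \<and>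
    witt_add p (\<omega> i) (x i) j = witt_add p (\<lambda>j. v i ^ (p ^ j) * \<theta> j) (\<lambda>j. x i j ^ p) j)"
proof -
  note field_intros = subfield_add[OF F] subfield_mult[OF F] subfield_power[OF F]
    subfield_diff[OF F] subfield_minus[OF F] subfield_witt_carry[OF F]
  obtain v where v: "\<And>i. i < l \<Longrightarrow> v i \<in> k"
    and solve: "\<And>n a. (\<And>i. i < l \<Longrightarrow> a i \<in> F) \<Longrightarrow>
      \<exists>c\<in>F. \<exists>d. \<forall>i<l. d i \<in> F \<and> v i ^ (p ^ n) * c = a i + d i ^ p - d i"
    using simultaneous_artin_schreier[OF p F k kF card] by auto
  let ?c = "\<lambda>x y j. poly_eval of_int (case_sum (truncate_seq j x) (truncate_seq j y)) (witt_carry p j)"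
  let ?R = "\<lambda>f i j. ?c (\<omega> i) (\<lambda>j. snd (f j) i) j"
  let ?R' = "\<lambda>f i j. ?c (\<lambda>j. v i ^ (p ^ j) * fst (f j)) (\<lambda>j. snd (f j) i ^ p) j"
  \<comment> \<open>Stage j of the recursion yields the pair of \<open>\<theta> j\<close> and the
    function sending i to \<open>x i j\<close>.\<close>
  let ?P = "\<lambda>f j (r :: 'a \<times> (nat \<Rightarrow> 'a)). j < m \<longrightarrow> fst r \<in> F \<and> (\<forall>i<l. snd r i \<in> F \<and>
    \<omega> i j + snd r i + ?R f i j = v i ^ (p ^ j) * fst r + snd r i ^ p + ?R' f i j)"
  have "\<exists>f. \<forall>j. ?P f j (f j)"
  proof (rule dependent_wellorder_choice)
    fix r and f g :: "nat \<Rightarrow> 'a \<times> (nat \<Rightarrow> 'a)" and j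
    assume fg: "\<And>y. y < j \<Longrightarrow> f y = g y"
    then have "truncate_seq j (\<lambda>j. snd (f j) i) = truncate_seq j (\<lambda>j. snd (g j) i)"
      "truncate_seq j (\<lambda>j. v i ^ (p ^ j) * fst (f j)) = truncate_seq j (\<lambda>j. v i ^ (p ^ j) * fst (g j))"
      "truncate_seq j (\<lambda>j. snd (f j) i ^ p) = truncate_seq j (\<lambda>j. snd (g j) i ^ p)" for i
      by (simp_all add: truncate_seq_def fun_eq_iff)
    then show "?P f j r = ?P g j r"
      by simp
  next
    fix j and f :: "nat \<Rightarrow> 'a \<times> (nat \<Rightarrow> 'a)"
    assume IH: "\<And>y. y < j \<Longrightarrow> ?P f y (f y)"
    show "\<exists>r. ?P f j r"
    proof (cases "j < m")
      case True
      have prev: "fst (f y) \<in> F" "\<And>i. i < l \<Longrightarrow> snd (f y) i \<in> F" if "y < j" for y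
        using IH[OF that] that True by auto
      have R: "?R f i j \<in> F" "?R' f i j \<in> F" if "i < l" for i
      proof -
        show "?R f i j \<in> F"
          by (intro field_intros) (use that True \<omega> prev in auto)
        show "?R' f i j \<in> F"
          by (intro field_intros) (use that v kF prev in auto)
      qed
      \<comment> \<open>The sign is reversed because \<open>d i\<close> stands next to \<omega> and
        its p-th power on the other side; accordingly \<open>- c\<close> becomes
        \<open>\<theta> j\<close>.\<close>
      let ?a = "\<lambda>i. - (\<omega> i j + ?R f i j - ?R' f i j)"
      have "?a i \<in> F" if "i < l" for i
        by (intro field_intros(1,4,5) R) (use that True \<omega> in auto)
      from solve[of ?a j, OF this]
      obtain c d where c: "c \<in> F" and d: "\<And>i. i < l \<Longrightarrow> d i \<in> F"
        and eq: "\<And>i. i < l \<Longrightarrow> v i ^ (p ^ j) * c = ?a i + d i ^ p - d i"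
        by blast
      have "\<omega> i j + d i + ?R f i j = v i ^ (p ^ j) * - c + d i ^ p + ?R' f i j" if "i < l" for i
        using eq[OF that] by (simp add: algebra_simps)
      then show ?thesis
        using c d by (intro exI[of _ "(- c, d)"]) (auto intro: field_intros)
    qed simp
  qed
  then obtain f where "\<And>j. ?P f j (f j)"
    by blast
  then show ?thesis
    by (intro exI[of _ v] exI[of _ "\<lambda>j. fst (f j)"] exI[of _ "\<lambda>i j. snd (f j) i"])
      (simp add: witt_add_carry[OF p(1)] v)
qed

subsection \<open>Scalar extension of symbols\<close>

lemma coset_map_r_coset:
  assumes G': "comm_group G'" and G: "comm_group G" and f: "f \<in> hom G' G"
    and N': "subgroup N' G'" and N: "subgroup N G" and fN: "f ` N' \<subseteq> N" and x: "x \<in> carrier G'"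
  shows "coset_map G N f (N' #>\<^bsub>G'\<^esub> x) = N #>\<^bsub>G\<^esub> f x"
proof -
  interpret G': comm_group G' by fact
  interpret G: comm_group G by fact
  interpret N': subgroup N' G' by fact
  interpret N: subgroup N G by fact
  have fx: "f x \<in> carrier G"
    using f x by (auto simp: hom_def)
  have f_mult: "f (n' \<otimes>\<^bsub>G'\<^esub> x) = f n' \<otimes>\<^bsub>G\<^esub> f x" "f n' \<in> N" if "n' \<in> N'" for n'
    using f x fN that N'.subset by (auto simp: hom_def)
  show ?thesis
  proof
    show "coset_map G N f (N' #>\<^bsub>G'\<^esub> x) \<subseteq> N #>\<^bsub>G\<^esub> f x"
    proof
      fix y assume "y \<in> coset_map G N f (N' #>\<^bsub>G'\<^esub> x)"
      then obtain n n' where n: "n \<in> N" "n' \<in> N'" "y = n \<otimes>\<^bsub>G\<^esub> f (n' \<otimes>\<^bsub>G'\<^esub> x)"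
        unfolding coset_map_def set_mult_def r_coset_def by blast
      then have "y = (n \<otimes>\<^bsub>G\<^esub> f n') \<otimes>\<^bsub>G\<^esub> f x"
        using f_mult[OF n(2)] fx N.mem_carrier by (simp add: G.m_assoc)
      moreover have "n \<otimes>\<^bsub>G\<^esub> f n' \<in> N"
        using n f_mult by simp
      ultimately show "y \<in> N #>\<^bsub>G\<^esub> f x"
        unfolding r_coset_def by blast
    qed
    have "x \<in> N' #>\<^bsub>G'\<^esub> x"
      by (rule G'.rcos_self[OF x N'])
    then show "N #>\<^bsub>G\<^esub> f x \<subseteq> coset_map G N f (N' #>\<^bsub>G'\<^esub> x)"
      unfolding coset_map_def set_mult_def r_coset_def by blast
  qed
qed

lemma coset_map_hom:
  assumes G': "comm_group G'" and G: "comm_group G" and f: "f \<in> hom G' G"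
    and N': "subgroup N' G'" and N: "subgroup N G" and fN: "f ` N' \<subseteq> N"
  shows "coset_map G N f \<in> hom (G' Mod N') (G Mod N)"
proof (rule homI)
  interpret N': normal N' G'
    using comm_group.subgroup_imp_normal[OF G' N'] .
  interpret N: normal N G
    using comm_group.subgroup_imp_normal[OF G N] .
  note map = coset_map_r_coset[OF assms]
  have fx: "f x \<in> carrier G" if "x \<in> carrier G'" for x
    using f that by (auto simp: hom_def)
  show "coset_map G N f U \<in> carrier (G Mod N)" if U: "U \<in> carrier (G' Mod N')" for U
  proof -
    obtain x where "x \<in> carrier G'" "U = N' #>\<^bsub>G'\<^esub> x"
      using U unfolding carrier_FactGroup by blast
    then show ?thesis
      unfolding carrier_FactGroup by (simp only: map) (rule imageI, rule fx)
  qed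
  show "coset_map G N f (U \<otimes>\<^bsub>G' Mod N'\<^esub> V) = coset_map G N f U \<otimes>\<^bsub>G Mod N\<^esub> coset_map G N f V"
    if UV: "U \<in> carrier (G' Mod N')" "V \<in> carrier (G' Mod N')" for U V
  proof -
    obtain x y where xy: "x \<in> carrier G'" "y \<in> carrier G'" "U = N' #>\<^bsub>G'\<^esub> x" "V = N' #>\<^bsub>G'\<^esub> y"
      using UV unfolding carrier_FactGroup by blast
    have "U \<otimes>\<^bsub>G' Mod N'\<^esub> V = N' #>\<^bsub>G'\<^esub> (x \<otimes>\<^bsub>G'\<^esub> y)"
      using xy by (simp add: N'.rcos_sum)
    then have "coset_map G N f (U \<otimes>\<^bsub>G' Mod N'\<^esub> V) = N #>\<^bsub>G\<^esub> f (x \<otimes>\<^bsub>G'\<^esub> y)"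
      using xy by (simp only: map N'.m_closed)
    also have "f (x \<otimes>\<^bsub>G'\<^esub> y) = f x \<otimes>\<^bsub>G\<^esub> f y"
      by (rule hom_mult[OF f xy(1,2)])
    also have "N #>\<^bsub>G\<^esub> (f x \<otimes>\<^bsub>G\<^esub> f y) = (N #>\<^bsub>G\<^esub> f x) <#>\<^bsub>G\<^esub> (N #>\<^bsub>G\<^esub> f y)"
      using xy by (simp add: N.rcos_sum fx)
    finally show ?thesis
      using xy by (simp only: map mult_FactGroup)
  qed
qed

lemma generate_image_subset:
  assumes "group G'" "group G" "f \<in> hom G' G" "S' \<subseteq> carrier G'" "f ` S' \<subseteq> S"
  shows "f ` generate G' S' \<subseteq> generate G S"
proof -
  interpret group_hom G' G f
    using assms by (simp add: group_hom_def group_hom_axioms_def)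
  show ?thesis
    using generate_img[OF assms(4)] H.mono_generate[OF assms(5)] by simp
qed

section \<open>Tensor groups as quotients of free abelian groups\<close>

lemma comm_group_tensor_free: "comm_group (tensor_free G H n)"
  unfolding tensor_free_def by (rule abelian_free_Abelian_group)

lemma frag_of_tensor_free:
  assumes "g \<in> carrier G" "length hs = n" "set hs \<subseteq> carrier H"
  shows "frag_of (g, hs) \<in> carrier (tensor_free G H n)"
  using assms by (simp add: tensor_free_def)

lemma diff_tensor_free:
  assumes "a \<in> carrier (tensor_free G H n)" "b \<in> carrier (tensor_free G H n)"
  shows "a - b \<in> carrier (tensor_free G H n)"
  using assms unfolding tensor_free_def carrier_free_Abelian_group_iff
  by (rule order_trans[OF keys_diff Un_least])

context
  fixes G :: "('g, 'x) monoid_scheme" and H :: "('h, 'y) monoid_scheme" and n :: nat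
  assumes G: "monoid G" and H: "monoid H"
begin

lemma multilinear_rels_closed: "multilinear_rels G H n \<subseteq> carrier (tensor_free G H n)"
proof -
  have upd: "set (hs[i := h]) \<subseteq> carrier H" if "set hs \<subseteq> carrier H" "h \<in> carrier H" for hs i h
    using that set_update_subset_insert[of hs i h] by auto
  show ?thesis
    unfolding multilinear_rels_def
    by (intro Un_least subsetI; elim CollectE exE conjE; hypsubst)
      (intro diff_tensor_free frag_of_tensor_free upd monoid.m_closed[OF G] monoid.m_closed[OF H];
        simp)+
qed

lemma subgroup_multilinear_subgroup: "subgroup (multilinear_subgroup G H n) (tensor_free G H n)"
  unfolding multilinear_subgroup_def
  by (rule group.generate_is_subgroup[OF _ multilinear_rels_closed])
    (rule comm_group.axioms(2)[OF comm_group_tensor_free])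

lemma comm_group_tensor_group: "comm_group (tensor_group G H n)"
  unfolding tensor_group_def
  by (rule comm_group.abelian_FactGroup[OF comm_group_tensor_free subgroup_multilinear_subgroup])

lemma pure_tensor_closed:
  assumes "g \<in> carrier G" "length hs = n" "set hs \<subseteq> carrier H"
  shows "pure_tensor G H n g hs \<in> carrier (tensor_group G H n)"
  using frag_of_tensor_free[OF assms]
  by (auto simp: tensor_group_def pure_tensor_def carrier_FactGroup)

lemma pure_tensor_mult:
  assumes g: "g \<in> carrier G" "g' \<in> carrier G" and hs: "length hs = n" "set hs \<subseteq> carrier H"
  shows "pure_tensor G H n (g \<otimes>\<^bsub>G\<^esub> g') hs =
    pure_tensor G H n g hs \<otimes>\<^bsub>tensor_group G H n\<^esub> pure_tensor G H n g' hs"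
proof -
  let ?T = "tensor_free G H n" and ?N = "multilinear_subgroup G H n"
  interpret T: comm_group ?T
    by (rule comm_group_tensor_free)
  interpret N: normal ?N ?T
    by (rule T.subgroup_imp_normal[OF subgroup_multilinear_subgroup])
  let ?a = "frag_of (g, hs)" and ?b = "frag_of (g', hs)" and ?c = "frag_of (g \<otimes>\<^bsub>G\<^esub> g', hs)"
  have carr: "?a \<in> carrier ?T" "?b \<in> carrier ?T" "?c \<in> carrier ?T"
    using assms monoid.m_closed[OF G g] by (auto intro!: frag_of_tensor_free)
  have rel: "?c - ?a - ?b \<in> ?N"
    unfolding multilinear_subgroup_def
    by (rule generate.incl) (use assms in \<open>auto simp: multilinear_rels_def\<close>)
  have mult: "x \<otimes>\<^bsub>?T\<^esub> y = x + y" for x y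
    by (simp add: tensor_free_def)
  have "?N #>\<^bsub>?T\<^esub> ?c = ?N #>\<^bsub>?T\<^esub> ((?c - ?a - ?b) \<otimes>\<^bsub>?T\<^esub> (?a \<otimes>\<^bsub>?T\<^esub> ?b))"
    by (simp add: mult)
  also have "\<dots> = ?N #>\<^bsub>?T\<^esub> (?c - ?a - ?b) #>\<^bsub>?T\<^esub> (?a \<otimes>\<^bsub>?T\<^esub> ?b)"
    using carr rel N.subset by (intro T.coset_mult_assoc[symmetric]) auto
  also have "?N #>\<^bsub>?T\<^esub> (?c - ?a - ?b) = ?N"
    using rel N.subset by (intro T.coset_join2 N.subgroup_axioms) auto
  also have "?N #>\<^bsub>?T\<^esub> (?a \<otimes>\<^bsub>?T\<^esub> ?b) = (?N #>\<^bsub>?T\<^esub> ?a) <#>\<^bsub>?T\<^esub> (?N #>\<^bsub>?T\<^esub> ?b)"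
    using carr by (simp add: N.rcos_sum)
  finally show ?thesis
    by (simp add: pure_tensor_def tensor_group_def)
qed

end

section \<open>Unit groups, the Kato-Milne relations and symbols\<close>

context
  fixes K :: "'a::field set"
  assumes K: "subfield K ambient"
begin

lemma carrier_unit_group [simp]: "carrier (unit_group K) = K - {0}"
  using subfield.subfield_Units[OF K] by (simp add: unit_group_def units_of_def ring_of_type_algebra_def)

lemma mult_unit_group [simp]: "x \<otimes>\<^bsub>unit_group K\<^esub> y = x * y"
  by (simp add: unit_group_def units_of_def ring_of_type_algebra_def)

lemma monoid_unit_group: "monoid (unit_group K)"
proof (rule monoidI)
  show "\<one>\<^bsub>unit_group K\<^esub> \<in> carrier (unit_group K)"
    by (auto simp: unit_group_def units_of_def ring_of_type_algebra_def subfield_1[OF K] Units_def)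
qed (auto simp: subfield_mult[OF K], simp_all add: unit_group_def units_of_def ring_of_type_algebra_def)

end

context
  fixes p :: nat and K :: "'a::field set"
  assumes p: "Factorial_Ring.prime p" and K: "subfield K ambient"
begin

lemma group_witt_group: "group (witt_group p m K)"
  using comm_group_witt_group[OF K p] by (rule comm_group.axioms(2))

lemma monoid_witt_group: "monoid (witt_group p m K)"
  using group_witt_group by (rule group.axioms(1))

lemma carrier_witt_ring: "carrier (witt_ring p m K) = carrier (witt_group p m K)"
  by (simp add: witt_group_def)

lemma witt_minus_eq:
  "x \<ominus>\<^bsub>witt_ring p m K\<^esub> y = x \<otimes>\<^bsub>witt_group p m K\<^esub> inv\<^bsub>witt_group p m K\<^esub> y"
  by (simp add: a_minus_def a_inv_def witt_group_def)

lemma witt_pow_closed: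
  "x \<in> carrier (witt_group p m K) \<Longrightarrow> witt_pow p x \<in> carrier (witt_group p m K)"
  by (auto simp: witt_group_simps[OF K] witt_pow_def intro: subfield_power[OF K])

lemma km_rels_artin_schreier:
  assumes "\<omega> \<in> carrier (witt_group p m K)" "length bs = n" "set bs \<subseteq> carrier (unit_group K)"
  shows "km_tensor p m n K (witt_pow p \<omega> \<ominus>\<^bsub>witt_ring p m K\<^esub> \<omega>) bs \<in> km_rels p m n K"
  unfolding km_rels_def carrier_witt_ring
  by (rule UnI1, rule UnI1, rule CollectI, intro exI conjI, rule refl) (fact assms)+

lemma km_rels_single:
  assumes "i < m" "a \<in> carrier (unit_group K)" "Suc (length bs) = n" "set bs \<subseteq> carrier (unit_group K)"
  shows "km_tensor p m n K ((replicate m 0)[i := a]) (a # bs) \<in> km_rels p m n K"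
  unfolding km_rels_def
  by (rule UnI1, rule UnI2, rule CollectI, intro exI conjI, rule refl) (fact assms)+

lemma km_rels_repeated:
  assumes "\<omega> \<in> carrier (witt_group p m K)" "length bs = n" "set bs \<subseteq> carrier (unit_group K)"
    "\<exists>i j. i < n \<and> j < n \<and> i \<noteq> j \<and> bs ! i = bs ! j"
  shows "km_tensor p m n K \<omega> bs \<in> km_rels p m n K"
  unfolding km_rels_def carrier_witt_ring
  by (rule UnI2, rule CollectI, rule exI[of _ \<omega>], rule exI[of _ bs]) (simp only: assms simp_thms)

lemma km_rels_cases [consumes 1, case_names artin_schreier single repeated]:
  assumes "r \<in> km_rels p m n K"
  obtains \<omega> bs where "r = km_tensor p m n K (witt_pow p \<omega> \<ominus>\<^bsub>witt_ring p m K\<^esub> \<omega>) bs"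
      "\<omega> \<in> carrier (witt_group p m K)" "length bs = n" "set bs \<subseteq> carrier (unit_group K)"
    | i a bs where "r = km_tensor p m n K ((replicate m 0)[i := a]) (a # bs)"
      "i < m" "a \<in> carrier (unit_group K)" "Suc (length bs) = n" "set bs \<subseteq> carrier (unit_group K)"
    | \<omega> bs where "r = km_tensor p m n K \<omega> bs"
      "\<omega> \<in> carrier (witt_group p m K)" "length bs = n" "set bs \<subseteq> carrier (unit_group K)"
      "\<exists>i j. i < n \<and> j < n \<and> i \<noteq> j \<and> bs ! i = bs ! j"
  using assms unfolding km_rels_def carrier_witt_ring Un_iff mem_Collect_eq
  by (elim disjE; (elim exE conjE)?) metis+

lemma km_rels_closed: "km_rels p m n K \<subseteq> carrier (km_tensor_group p m n K)"
proof -
  note closed = pure_tensor_closed[OF monoid_witt_group monoid_unit_group[OF K]]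
  have minus: "witt_pow p \<omega> \<ominus>\<^bsub>witt_ring p m K\<^esub> \<omega> \<in> carrier (witt_group p m K)"
    if "\<omega> \<in> carrier (witt_group p m K)" for \<omega>
    unfolding witt_minus_eq using that
    by (intro monoid.m_closed[OF monoid_witt_group] witt_pow_closed group.inv_closed[OF group_witt_group])
  have single: "(replicate m 0)[i := a] \<in> carrier (witt_group p m K)" if "a \<in> K" for i a
    using that set_update_subset_insert[of "replicate m 0" i a] subfield_0[OF K]
    by (auto simp: witt_group_simps[OF K])
  show ?thesis
  proof
    fix r assume "r \<in> km_rels p m n K"
    then show "r \<in> carrier (km_tensor_group p m n K)"
      by (cases rule: km_rels_cases)
        (auto intro!: closed minus single simp: carrier_unit_group[OF K] simp del: witt_group_simps)
  qed
qed

lemma comm_group_km_tensor_group: "comm_group (km_tensor_group p m n K)"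
  by (rule comm_group_tensor_group[OF monoid_witt_group monoid_unit_group[OF K]])

lemma subgroup_km_subgroup: "subgroup (km_subgroup p m n K) (km_tensor_group p m n K)"
  unfolding km_subgroup_def
  by (rule group.generate_is_subgroup[OF _ km_rels_closed])
    (rule comm_group.axioms(2)[OF comm_group_km_tensor_group])

lemma comm_group_kato_milne: "comm_group (kato_milne p m n K)"
  unfolding kato_milne_def
  by (rule comm_group.abelian_FactGroup[OF comm_group_km_tensor_group subgroup_km_subgroup])

lemma km_tensor_closed:
  assumes "\<omega> \<in> carrier (witt_group p m K)" "length bs = n" "set bs \<subseteq> carrier (unit_group K)"
  shows "km_tensor p m n K \<omega> bs \<in> carrier (km_tensor_group p m n K)"
  by (rule pure_tensor_closed[OF monoid_witt_group monoid_unit_group[OF K] assms])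

lemma km_symbol_closed:
  assumes "\<omega> \<in> carrier (witt_group p m K)" "length bs = n" "set bs \<subseteq> carrier (unit_group K)"
  shows "km_symbol p m n K \<omega> bs \<in> carrier (kato_milne p m n K)"
  using km_tensor_closed[OF assms] by (auto simp: km_symbol_def kato_milne_def carrier_FactGroup)

text \<open>The equation says that \<omega> is \<omega>' plus x^p - x; the symbol of x^p - x
  vanishes by the first kind of relation, and the tensor is additive in its Witt slot. The
  hypothesis has the subtraction-free form delivered by
  \<open>simultaneous_witt_reduction\<close>.\<close>

lemma km_symbol_cong:
  assumes carr: "\<omega> \<in> carrier (witt_group p m K)" "\<omega>' \<in> carrier (witt_group p m K)"
      "x \<in> carrier (witt_group p m K)"
    and bs: "length bs = n" "set bs \<subseteq> carrier (unit_group K)"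
    and eq: "\<omega> \<otimes>\<^bsub>witt_group p m K\<^esub> x = \<omega>' \<otimes>\<^bsub>witt_group p m K\<^esub> witt_pow p x"
  shows "km_symbol p m n K \<omega> bs = km_symbol p m n K \<omega>' bs"
proof -
  let ?W = "witt_group p m K" and ?T = "km_tensor_group p m n K" and ?N = "km_subgroup p m n K"
  interpret W: comm_group ?W
    by (rule comm_group_witt_group[OF K p])
  interpret T: comm_group ?T
    by (rule comm_group_km_tensor_group)
  interpret N: normal ?N ?T
    by (rule T.subgroup_imp_normal[OF subgroup_km_subgroup])
  let ?u = "witt_pow p x \<ominus>\<^bsub>witt_ring p m K\<^esub> x"
  have pow: "witt_pow p x \<in> carrier ?W"
    using carr by (intro witt_pow_closed)
  then have u: "?u \<in> carrier ?W"
    using carr by (simp add: witt_minus_eq del: witt_group_simps)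
  have "\<omega> = (\<omega> \<otimes>\<^bsub>?W\<^esub> x) \<otimes>\<^bsub>?W\<^esub> inv\<^bsub>?W\<^esub> x"
    using carr by (simp add: W.m_assoc del: witt_group_simps)
  also have "\<dots> = \<omega>' \<otimes>\<^bsub>?W\<^esub> ?u"
    using carr pow unfolding eq witt_minus_eq by (simp add: W.m_assoc del: witt_group_simps)
  finally have \<omega>: "\<omega> = \<omega>' \<otimes>\<^bsub>?W\<^esub> ?u" .
  have "km_tensor p m n K ?u bs \<in> ?N"
    unfolding km_subgroup_def
    by (rule generate.incl) (rule km_rels_artin_schreier[OF carr(3) bs])
  then have "?N #>\<^bsub>?T\<^esub> km_tensor p m n K ?u bs = ?N"
    using N.subset by (intro T.coset_join2 N.subgroup_axioms) auto
  moreover have "km_tensor p m n K \<omega> bs = km_tensor p m n K ?u bs \<otimes>\<^bsub>?T\<^esub> km_tensor p m n K \<omega>' bs"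
    unfolding \<omega>
    using pure_tensor_mult[OF monoid_witt_group monoid_unit_group[OF K] carr(2) u bs]
      km_tensor_closed[OF carr(2) bs] km_tensor_closed[OF u bs]
    by (simp only: T.m_comm)
  moreover have "?N #>\<^bsub>?T\<^esub> (km_tensor p m n K ?u bs \<otimes>\<^bsub>?T\<^esub> km_tensor p m n K \<omega>' bs) =
      ?N #>\<^bsub>?T\<^esub> km_tensor p m n K ?u bs #>\<^bsub>?T\<^esub> km_tensor p m n K \<omega>' bs"
    using km_tensor_closed[OF carr(2) bs] km_tensor_closed[OF u bs] N.subset
    by (intro T.coset_mult_assoc[symmetric]) auto
  ultimately show ?thesis
    by (simp add: km_symbol_def)
qed

end

section \<open>Scalar extension from E to F\<close>

context
  fixes p :: nat and E F :: "'a::field set"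
  assumes p: "Factorial_Ring.prime p" and E: "subfield E ambient" and F: "subfield F ambient"
    and EF: "E \<subseteq> F"
begin

lemma carrier_witt_group_mono: "carrier (witt_group p m E) \<subseteq> carrier (witt_group p m F)"
  using EF by (auto simp: witt_group_simps[OF E] witt_group_simps[OF F])

lemma carrier_unit_group_mono: "carrier (unit_group E) \<subseteq> carrier (unit_group F)"
  using EF by (auto simp: carrier_unit_group[OF E] carrier_unit_group[OF F])

text \<open>The group inverse is defined relative to the carrier, so the relations over E and over F
  formally use different subtractions; uniqueness of inverses over F identifies them.\<close>

lemma witt_minus_mono:
  assumes "x \<in> carrier (witt_group p m E)"
  shows "y \<ominus>\<^bsub>witt_ring p m E\<^esub> x = y \<ominus>\<^bsub>witt_ring p m F\<^esub> x"
proof -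
  have "inv\<^bsub>witt_group p m F\<^esub> x = inv\<^bsub>witt_group p m E\<^esub> x"
  proof (rule group.inv_equality[OF group_witt_group[OF p F]])
    have "inv\<^bsub>witt_group p m E\<^esub> x \<otimes>\<^bsub>witt_group p m E\<^esub> x = \<one>\<^bsub>witt_group p m E\<^esub>"
      by (rule group.l_inv[OF group_witt_group[OF p E] assms])
    then show "inv\<^bsub>witt_group p m E\<^esub> x \<otimes>\<^bsub>witt_group p m F\<^esub> x = \<one>\<^bsub>witt_group p m F\<^esub>"
      by (simp add: witt_group_simps[OF E] witt_group_simps[OF F])
  qed (use assms carrier_witt_group_mono group.inv_closed[OF group_witt_group[OF p E] assms] in auto)
  then show ?thesis
    by (simp add: witt_minus_eq[OF p E] witt_minus_eq[OF p F] witt_group_simps[OF E] witt_group_simps[OF F])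
qed

lemma tensor_free_hom:
  "(\<lambda>c. c) \<in> hom (tensor_free (witt_group p m E) (unit_group E) n)
    (tensor_free (witt_group p m F) (unit_group F) n)"
  using carrier_witt_group_mono[of m] carrier_unit_group_mono
  by (fastforce simp: hom_def tensor_free_def)

lemma multilinear_subgroup_mono:
  "(\<lambda>c. c) ` multilinear_subgroup (witt_group p m E) (unit_group E) n \<subseteq>
    multilinear_subgroup (witt_group p m F) (unit_group F) n"
  unfolding multilinear_subgroup_def
proof (rule generate_image_subset[OF _ _ tensor_free_hom])
  show "(\<lambda>c. c) ` multilinear_rels (witt_group p m E) (unit_group E) n \<subseteq>
      multilinear_rels (witt_group p m F) (unit_group F) n"
    using EF unfolding multilinear_rels_def image_ident
    unfolding witt_group_simps[OF E] witt_group_simps[OF F] carrier_unit_group[OF E]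
      carrier_unit_group[OF F] mult_unit_group[OF E] mult_unit_group[OF F]
    by (intro Un_mono Collect_mono) (blast, blast)
  show "multilinear_rels (witt_group p m E) (unit_group E) n \<subseteq>
      carrier (tensor_free (witt_group p m E) (unit_group E) n)"
    by (rule multilinear_rels_closed[OF monoid_witt_group[OF p E] monoid_unit_group[OF E]])
qed (rule comm_group.axioms(2)[OF comm_group_tensor_free])+

text \<open>The inner of the two nested quotient maps in \<open>km_res\<close>, named so that the
  general facts on \<open>coset_map\<close> can be applied once per layer.\<close>

definition km_tensor_res :: "nat \<Rightarrow> nat \<Rightarrow> ('a list \<times> 'a list \<Rightarrow>\<^sub>0 int) set \<Rightarrow> ('a list \<times> 'a list \<Rightarrow>\<^sub>0 int) set"
  where "km_tensor_res m n = coset_map (tensor_free (witt_group p m F) (unit_group F) n)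
    (multilinear_subgroup (witt_group p m F) (unit_group F) n) (\<lambda>c. c)"

lemma km_tensor_res_hom: "km_tensor_res m n \<in> hom (km_tensor_group p m n E) (km_tensor_group p m n F)"
  unfolding km_tensor_res_def tensor_group_def
  by (intro coset_map_hom comm_group_tensor_free tensor_free_hom multilinear_subgroup_mono
      subgroup_multilinear_subgroup monoid_witt_group[OF p E] monoid_witt_group[OF p F]
      monoid_unit_group[OF E] monoid_unit_group[OF F])

lemma km_tensor_res_tensor:
  assumes "\<omega> \<in> carrier (witt_group p m E)" "length bs = n" "set bs \<subseteq> carrier (unit_group E)"
  shows "km_tensor_res m n (km_tensor p m n E \<omega> bs) = km_tensor p m n F \<omega> bs"
  unfolding km_tensor_res_def pure_tensor_def
  by (intro coset_map_r_coset comm_group_tensor_free tensor_free_hom multilinear_subgroup_mono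
      subgroup_multilinear_subgroup monoid_witt_group[OF p E] monoid_witt_group[OF p F]
      monoid_unit_group[OF E] monoid_unit_group[OF F] frag_of_tensor_free assms)

lemma km_tensor_res_rels: "km_tensor_res m n ` km_rels p m n E \<subseteq> km_rels p m n F"
proof -
  have bs: "set bs \<subseteq> carrier (unit_group F)" if "set bs \<subseteq> carrier (unit_group E)" for bs
    using that carrier_unit_group_mono by blast
  have \<omega>: "x \<in> carrier (witt_group p m F)" if "x \<in> carrier (witt_group p m E)" for x
    using that carrier_witt_group_mono by blast
  have minus: "witt_pow p x \<ominus>\<^bsub>witt_ring p m E\<^esub> x \<in> carrier (witt_group p m E)"
    if "x \<in> carrier (witt_group p m E)" for x
    unfolding witt_minus_eq[OF p E] using that
    by (intro monoid.m_closed[OF monoid_witt_group[OF p E]] witt_pow_closed[OF p E]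
        group.inv_closed[OF group_witt_group[OF p E]])
  show ?thesis
  proof
    fix y assume "y \<in> km_tensor_res m n ` km_rels p m n E"
    then obtain r where r: "r \<in> km_rels p m n E" "y = km_tensor_res m n r"
      by blast
    from r(1) show "y \<in> km_rels p m n F"
    proof (cases rule: km_rels_cases[OF p E, consumes 1, case_names artin_schreier single repeated])
      case (artin_schreier \<omega> bs)
      then have "y = km_tensor p m n F (witt_pow p \<omega> \<ominus>\<^bsub>witt_ring p m F\<^esub> \<omega>) bs"
        using r(2) minus by (simp only: km_tensor_res_tensor witt_minus_mono)
      then show ?thesis
        using artin_schreier bs \<omega> km_rels_artin_schreier[OF p F] by simp
    next
      case (single i a bs)
      have "(replicate m 0)[i := a] \<in> carrier (witt_group p m E)"
        using single set_update_subset_insert[of "replicate m 0" i a] subfield_0[OF E]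
        by (auto simp: witt_group_simps[OF E] carrier_unit_group[OF E])
      then have "y = km_tensor p m n F ((replicate m 0)[i := a]) (a # bs)"
        using r(2) single by (simp add: km_tensor_res_tensor)
      then show ?thesis
        using single bs subsetD[OF carrier_unit_group_mono] km_rels_single[OF p F] by simp
    next
      case (repeated \<omega> bs)
      then have "y = km_tensor p m n F \<omega> bs"
        using r(2) by (simp only: km_tensor_res_tensor)
      then show ?thesis
        using repeated(2-5) bs \<omega> km_rels_repeated[OF p F] by simp
    qed
  qed
qed

lemma km_tensor_res_subgroup: "km_tensor_res m n ` km_subgroup p m n E \<subseteq> km_subgroup p m n F"
  unfolding km_subgroup_def
  by (intro generate_image_subset km_tensor_res_hom km_tensor_res_rels km_rels_closed[OF p E]
      comm_group.axioms(2) comm_group_km_tensor_group[OF p E] comm_group_km_tensor_group[OF p F])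

lemma km_res_hom: "km_res p m n F \<in> hom (kato_milne p m n E) (kato_milne p m n F)"
  unfolding km_res_def kato_milne_def km_tensor_res_def[symmetric]
  by (intro coset_map_hom km_tensor_res_hom km_tensor_res_subgroup
      comm_group_km_tensor_group[OF p E] comm_group_km_tensor_group[OF p F]
      subgroup_km_subgroup[OF p E] subgroup_km_subgroup[OF p F])

lemma km_res_symbol:
  assumes "\<omega> \<in> carrier (witt_group p m E)" "length bs = n" "set bs \<subseteq> carrier (unit_group E)"
  shows "km_res p m n F (km_symbol p m n E \<omega> bs) = km_symbol p m n F \<omega> bs"
proof -
  have "km_res p m n F (km_symbol p m n E \<omega> bs) =
      km_subgroup p m n F #>\<^bsub>km_tensor_group p m n F\<^esub> km_tensor_res m n (km_tensor p m n E \<omega> bs)"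
    unfolding km_res_def km_symbol_def km_tensor_res_def[symmetric]
    by (intro coset_map_r_coset km_tensor_res_hom km_tensor_res_subgroup km_tensor_closed[OF p E]
        comm_group_km_tensor_group[OF p E] comm_group_km_tensor_group[OF p F]
        subgroup_km_subgroup[OF p E] subgroup_km_subgroup[OF p F] assms)
  then show ?thesis
    by (simp only: km_tensor_res_tensor[OF assms] km_symbol_def)
qed

lemma km_res_finprod_symbols:
  fixes l :: nat
  assumes "\<And>i. i < l \<Longrightarrow> \<omega> i \<in> carrier (witt_group p m E) \<and> length (bs i) = n \<and>
      set (bs i) \<subseteq> carrier (unit_group E)"
  shows "\<exists>y\<in>carrier (kato_milne p m n E).
    km_res p m n F y = finprod (kato_milne p m n F) (\<lambda>i. km_symbol p m n F (\<omega> i) (bs i)) {..<l}"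
  using assms
proof (induction l)
  case 0
  interpret KE: comm_group "kato_milne p m n E"
    by (rule comm_group_kato_milne[OF p E])
  interpret KF: comm_group "kato_milne p m n F"
    by (rule comm_group_kato_milne[OF p F])
  have "km_res p m n F \<one>\<^bsub>kato_milne p m n E\<^esub> = \<one>\<^bsub>kato_milne p m n F\<^esub>"
    using hom_one[OF km_res_hom KE.is_group KF.is_group] .
  then show ?case
    by (intro bexI[of _ "\<one>\<^bsub>kato_milne p m n E\<^esub>"]) auto
next
  case (Suc l)
  interpret KE: comm_group "kato_milne p m n E"
    by (rule comm_group_kato_milne[OF p E])
  interpret KF: comm_group "kato_milne p m n F"
    by (rule comm_group_kato_milne[OF p F])
  have symb: "km_symbol p m n F (\<omega> i) (bs i) \<in> carrier (kato_milne p m n F)" if "i < Suc l" for i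
    using Suc.prems[OF that] carrier_witt_group_mono carrier_unit_group_mono
    by (intro km_symbol_closed[OF p F]) auto
  have E_symb: "km_symbol p m n E (\<omega> l) (bs l) \<in> carrier (kato_milne p m n E)"
    using Suc.prems[of l] by (intro km_symbol_closed[OF p E]) auto
  obtain y where y: "y \<in> carrier (kato_milne p m n E)" "km_res p m n F y =
      finprod (kato_milne p m n F) (\<lambda>i. km_symbol p m n F (\<omega> i) (bs i)) {..<l}"
    using Suc.IH Suc.prems by auto
  have "finprod (kato_milne p m n F) (\<lambda>i. km_symbol p m n F (\<omega> i) (bs i)) {..<Suc l} =
      km_symbol p m n F (\<omega> l) (bs l) \<otimes>\<^bsub>kato_milne p m n F\<^esub>
        finprod (kato_milne p m n F) (\<lambda>i. km_symbol p m n F (\<omega> i) (bs i)) {..<l}"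
    unfolding lessThan_Suc by (rule KF.finprod_insert) (use symb in auto)
  also have "\<dots> = km_res p m n F (km_symbol p m n E (\<omega> l) (bs l) \<otimes>\<^bsub>kato_milne p m n E\<^esub> y)"
    using Suc.prems[of l] y(2)
    by (simp only: hom_mult[OF km_res_hom E_symb y(1)]) (subst km_res_symbol, auto)
  finally show ?case
    by (intro bexI[OF _ KE.m_closed[OF E_symb y(1)]]) simp
qed

end

subsection \<open>Transcendence degree of finitely generated fields\<close>

text \<open>Gaussian elimination with J indexing equations and I unknowns. It is carried out
  relative to a subfield, because the solution has to lie in K and not merely in the ambient
  field.\<close>

lemma homogeneous_system_nontrivial_solution:
  fixes A :: "'j \<Rightarrow> 'i \<Rightarrow> 'a::field"
  assumes K: "subfield K ambient" and "finite J" "finite I" "card J < card I"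
    and "\<And>j i. j \<in> J \<Longrightarrow> i \<in> I \<Longrightarrow> A j i \<in> K"
  shows "\<exists>c. (\<forall>i\<in>I. c i \<in> K) \<and> (\<exists>i\<in>I. c i \<noteq> 0) \<and> (\<forall>j\<in>J. (\<Sum>i\<in>I. A j i * c i) = 0)"
  using assms(2-)
proof (induction J arbitrary: I A rule: finite_induct)
  case empty
  then have "I \<noteq> {}"
    by auto
  then show ?case
    by (intro exI[of _ "\<lambda>_. 1"]) (auto simp: subfield_1[OF K])
next
  case (insert j0 J)
  have card: "Suc (card J) < card I"
    using insert by simp
  show ?case
  proof (cases "\<forall>i\<in>I. A j0 i = 0")
    case True
    have "\<exists>c. (\<forall>i\<in>I. c i \<in> K) \<and> (\<exists>i\<in>I. c i \<noteq> 0) \<and> (\<forall>j\<in>J. (\<Sum>i\<in>I. A j i * c i) = 0)"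
      using insert.prems card by (intro insert.IH) auto
    with True show ?thesis
      by auto
  next
    case False
    then obtain i0 where i0: "i0 \<in> I" "A j0 i0 \<noteq> 0"
      by blast
    let ?I = "I - {i0}"
    \<comment> \<open>The remaining equations after eliminating the unknown i0 by means of equation
      j0; its value is restored in \<open>c'\<close>.\<close>
    let ?A = "\<lambda>j i. A j i - A j i0 * A j0 i / A j0 i0"
    have "\<exists>c. (\<forall>i\<in>?I. c i \<in> K) \<and> (\<exists>i\<in>?I. c i \<noteq> 0) \<and> (\<forall>j\<in>J. (\<Sum>i\<in>?I. ?A j i * c i) = 0)"
    proof (rule insert.IH)
      show "card J < card ?I"
        using card i0 insert.prems by simp
      show "?A j i \<in> K" if "j \<in> J" "i \<in> ?I" for j i
        using that i0 insert.prems
        by (intro subfield_diff[OF K] subfield_divide[OF K] subfield_mult[OF K]) auto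
    qed (use insert.prems in auto)
    then obtain c where c: "\<And>i. i \<in> ?I \<Longrightarrow> c i \<in> K" "\<exists>i\<in>?I. c i \<noteq> 0"
      and c_eq: "\<And>j. j \<in> J \<Longrightarrow> (\<Sum>i\<in>?I. ?A j i * c i) = 0"
      by blast
    define s where "s = (\<Sum>i\<in>?I. A j0 i * c i)"
    define c' where "c' = c(i0 := - s / A j0 i0)"
    have s: "s \<in> K"
      unfolding s_def using c insert.prems
      by (intro subfield_sum[OF K] subfield_mult[OF K]) auto
    have sum: "(\<Sum>i\<in>I. A j i * c' i) = (\<Sum>i\<in>?I. A j i * c i) - A j i0 * s / A j0 i0" for j
    proof -
      have "(\<Sum>i\<in>?I. A j i * c' i) = (\<Sum>i\<in>?I. A j i * c i)"
        by (rule sum.cong) (auto simp: c'_def)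
      then show ?thesis
        using i0 insert.prems(1) by (simp add: sum.remove[of I i0] c'_def)
    qed
    have "(\<Sum>i\<in>I. A j i * c' i) = 0" if "j \<in> insert j0 J" for j
    proof (cases "j = j0")
      case True
      then show ?thesis
        using i0 sum[of j0] by (simp add: s_def)
    next
      case False
      then have "(\<Sum>i\<in>?I. ?A j i * c i) = 0"
        using that c_eq by blast
      also have "(\<Sum>i\<in>?I. ?A j i * c i) = (\<Sum>i\<in>?I. A j i * c i) - A j i0 * s / A j0 i0"
        by (simp add: s_def left_diff_distrib sum_subtractf sum_distrib_left sum_divide_distrib mult.assoc)
      finally show ?thesis
        by (simp add: sum)
    qed
    moreover have "c' i \<in> K" if "i \<in> I" for i
      using that c s i0 insert.prems
      by (auto simp: c'_def intro!: subfield_divide[OF K] subfield_minus[OF K])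
    moreover have "\<exists>i\<in>I. c' i \<noteq> 0"
      using c by (auto simp: c'_def)
    ultimately show ?thesis
      by blast
  qed
qed

lemma subfield_ambientI:
  fixes K :: "'a::field set"
  assumes "1 \<in> K" "\<And>a. a \<in> K \<Longrightarrow> - a \<in> K" "\<And>a b. a \<in> K \<Longrightarrow> b \<in> K \<Longrightarrow> a * b \<in> K"
    "\<And>a b. a \<in> K \<Longrightarrow> b \<in> K \<Longrightarrow> a + b \<in> K" "\<And>a. a \<in> K \<Longrightarrow> inverse a \<in> K"
  shows "subfield K ambient"
proof -
  interpret R: field "ambient :: 'a ring"
    by (rule field_from_type_algebra)
  note ring_simps = ring_of_type_algebra_def
  have minus: "\<ominus>\<^bsub>ambient\<^esub> a = - a" for a :: 'a
    by (rule R.minus_equality) (auto simp: ring_simps)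
  have inv: "inv\<^bsub>ambient\<^esub> a = inverse a" if "a \<noteq> 0" for a :: 'a
    by (rule R.comm_inv_char) (use that in \<open>auto simp: ring_simps\<close>)
  show ?thesis
  proof (rule R.subfieldI')
    show "subring K ambient"
      by (rule R.subringI) (use assms in \<open>auto simp: minus, auto simp: ring_simps\<close>)
    show "inv\<^bsub>ambient\<^esub> a \<in> K" if "a \<in> K - {\<zero>\<^bsub>ambient\<^esub>}" for a
    proof -
      have "a \<in> K" "a \<noteq> 0"
        using that by (auto simp: ring_simps)
      then show ?thesis
        using assms(5) inv by simp
    qed
  qed
qed

section \<open>The field generated by finitely many elements, and its transcendence degree\<close>

context
  fixes K :: "'a::field set" and g :: "nat \<Rightarrow> 'a" and N :: nat
  assumes K: "subfield K ambient"
begin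

definition power_product :: "(nat \<Rightarrow> nat) \<Rightarrow> 'a"
  where "power_product e = (\<Prod>i<N. g i ^ e i)"

text \<open>The exponent is bounded in each variable separately, which makes the number of exponent
  vectors exactly (M+1)^N; extensional functions count each vector once.\<close>

definition exponent_box :: "nat \<Rightarrow> (nat \<Rightarrow> nat) set"
  where "exponent_box M = {..<N} \<rightarrow>\<^sub>E {..M}"

definition bounded_polys :: "nat \<Rightarrow> 'a set"
  where "bounded_polys M =
    {\<Sum>e\<in>exponent_box M. c e * power_product e | c. \<forall>e\<in>exponent_box M. c e \<in> K}"

definition polynomial_values :: "'a set"
  where "polynomial_values = (\<Union>M. bounded_polys M)"

text \<open>The field K(g_0, ..., g_(N-1)), written as fractions of polynomial values so that
  denominators can be cleared.\<close>

definition quotient_values :: "'a set"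
  where "quotient_values = {a / b | a b. a \<in> polynomial_values \<and> b \<in> polynomial_values \<and> b \<noteq> 0}"

lemma finite_exponent_box: "finite (exponent_box M)"
  by (simp add: exponent_box_def finite_PiE)

lemma card_exponent_box: "card (exponent_box M) = Suc M ^ N"
  by (simp add: exponent_box_def card_PiE)

lemma bounded_polys_smult_power_product:
  assumes "c \<in> K" "\<And>i. i < N \<Longrightarrow> e i \<le> M"
  shows "c * power_product e \<in> bounded_polys M"
proof -
  let ?e = "restrict e {..<N}"
  have e: "?e \<in> exponent_box M"
    using assms by (auto simp: exponent_box_def)
  have "power_product ?e = power_product e"
    by (simp add: power_product_def)
  then have "c * power_product e = (\<Sum>e'\<in>exponent_box M. (if e' = ?e then c else 0) * power_product e')"
    using e by (simp add: if_distrib[of "\<lambda>x. x * _"] sum.delta finite_exponent_box cong: if_cong)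
  then show ?thesis
    unfolding bounded_polys_def using assms(1) subfield_0[OF K] by auto
qed

lemma bounded_polys_zero: "0 \<in> bounded_polys M"
  unfolding bounded_polys_def using subfield_0[OF K] by (auto intro!: exI[of _ "\<lambda>_. 0"])

lemma bounded_polys_add:
  assumes "x \<in> bounded_polys M" "y \<in> bounded_polys M"
  shows "x + y \<in> bounded_polys M"
proof -
  obtain c d where "\<forall>e\<in>exponent_box M. c e \<in> K" "x = (\<Sum>e\<in>exponent_box M. c e * power_product e)"
    "\<forall>e\<in>exponent_box M. d e \<in> K" "y = (\<Sum>e\<in>exponent_box M. d e * power_product e)"
    using assms unfolding bounded_polys_def by blast
  then show ?thesis
    unfolding bounded_polys_def
    by (auto simp: sum.distrib ring_distribs intro!: exI[of _ "\<lambda>e. c e + d e"] subfield_add[OF K])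
qed

lemma bounded_polys_sum: "(\<And>i. i \<in> I \<Longrightarrow> f i \<in> bounded_polys M) \<Longrightarrow> sum f I \<in> bounded_polys M"
  by (induction I rule: infinite_finite_induct) (auto intro: bounded_polys_zero bounded_polys_add)

lemma bounded_polys_mult:
  assumes "x \<in> bounded_polys M" "y \<in> bounded_polys M'"
  shows "x * y \<in> bounded_polys (M + M')"
proof -
  obtain c d where c: "\<And>e. e \<in> exponent_box M \<Longrightarrow> c e \<in> K"
    and x: "x = (\<Sum>e\<in>exponent_box M. c e * power_product e)"
    and d: "\<And>e. e \<in> exponent_box M' \<Longrightarrow> d e \<in> K"
    and y: "y = (\<Sum>e\<in>exponent_box M'. d e * power_product e)"
    using assms unfolding bounded_polys_def by blast
  have "x * y = (\<Sum>e\<in>exponent_box M. \<Sum>e'\<in>exponent_box M'.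
      (c e * d e') * power_product (\<lambda>i. e i + e' i))"
    by (simp add: x y sum_product power_product_def power_add prod.distrib mult_ac)
  also have "\<dots> \<in> bounded_polys (M + M')"
  proof (intro bounded_polys_sum bounded_polys_smult_power_product subfield_mult[OF K] c d)
    fix e e' i assume "e \<in> exponent_box M" "e' \<in> exponent_box M'" "i < N"
    then show "e i + e' i \<le> M + M'"
      by (intro add_mono) (auto simp: exponent_box_def PiE_iff)
  qed
  finally show ?thesis .
qed

lemma bounded_polys_const: "c \<in> K \<Longrightarrow> c \<in> bounded_polys M"
  using bounded_polys_smult_power_product[of c "\<lambda>_. 0" M] by (simp add: power_product_def)

lemma bounded_polys_generator:
  assumes "i < N"
  shows "g i \<in> bounded_polys 1"
proof -
  have "(\<Prod>j<N. g j ^ (if j = i then 1 else 0)) = g i"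
    using assms by (simp add: if_distrib[of "\<lambda>e. _ ^ e"] prod.delta cong: if_cong)
  then show ?thesis
    using bounded_polys_smult_power_product[of 1 "\<lambda>j. if j = i then 1 else 0" 1]
    by (simp add: power_product_def subfield_1[OF K])
qed

lemma bounded_polys_mono:
  assumes "x \<in> bounded_polys M" "M \<le> M'"
  shows "x \<in> bounded_polys M'"
  using bounded_polys_mult[OF assms(1) bounded_polys_const[OF subfield_1[OF K], of "M' - M"]] assms(2)
  by simp

lemma bounded_polys_power: "x \<in> bounded_polys M \<Longrightarrow> x ^ k \<in> bounded_polys (k * M)"
  by (induction k) (auto intro: bounded_polys_mult bounded_polys_const subfield_1[OF K])

lemma bounded_polys_prod:
  assumes "finite I" "\<And>i. i \<in> I \<Longrightarrow> f i \<in> bounded_polys M"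
  shows "prod f I \<in> bounded_polys (card I * M)"
  using assms
  by (induction I rule: finite_induct)
    (auto intro: bounded_polys_mult bounded_polys_const subfield_1[OF K])

lemma polynomial_values_const: "c \<in> K \<Longrightarrow> c \<in> polynomial_values"
  using bounded_polys_const by (auto simp: polynomial_values_def)

lemma polynomial_values_generator: "i < N \<Longrightarrow> g i \<in> polynomial_values"
  using bounded_polys_generator by (auto simp: polynomial_values_def)

lemma polynomial_values_mult:
  "x \<in> polynomial_values \<Longrightarrow> y \<in> polynomial_values \<Longrightarrow> x * y \<in> polynomial_values"
  unfolding polynomial_values_def by (blast intro: bounded_polys_mult)

lemma polynomial_values_add:
  assumes "x \<in> polynomial_values" "y \<in> polynomial_values"
  shows "x + y \<in> polynomial_values"
proof -
  obtain M M' where "x \<in> bounded_polys M" "y \<in> bounded_polys M'"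
    using assms by (auto simp: polynomial_values_def)
  then have "x + y \<in> bounded_polys (max M M')"
    by (intro bounded_polys_add) (auto elim: bounded_polys_mono)
  then show ?thesis
    by (auto simp: polynomial_values_def)
qed

lemma polynomial_values_subset:
  assumes "subfield F ambient" "K \<subseteq> F" "\<And>i. i < N \<Longrightarrow> g i \<in> F"
  shows "polynomial_values \<subseteq> F"
  unfolding polynomial_values_def bounded_polys_def power_product_def
  using assms(2,3)
  by (auto intro!: subfield_sum[OF assms(1)] subfield_mult[OF assms(1)] subfield_prod[OF assms(1)]
      subfield_power[OF assms(1)])

lemma quotient_values_subset:
  assumes "subfield F ambient" "K \<subseteq> F" "\<And>i. i < N \<Longrightarrow> g i \<in> F"
  shows "quotient_values \<subseteq> F"
  using polynomial_values_subset[OF assms]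
  by (auto simp: quotient_values_def intro!: subfield_divide[OF assms(1)])

lemma polynomial_values_subset_quotient_values: "polynomial_values \<subseteq> quotient_values"
proof
  fix a assume "a \<in> polynomial_values"
  then show "a \<in> quotient_values"
    unfolding quotient_values_def
    using polynomial_values_const[OF subfield_1[OF K]] by (intro CollectI exI[of _ a] exI[of _ 1]) auto
qed

lemma subfield_quotient_values: "subfield quotient_values ambient"
proof -
  have neg: "- a \<in> polynomial_values" if "a \<in> polynomial_values" for a
    using polynomial_values_mult[OF polynomial_values_const[OF subfield_minus[OF K subfield_1[OF K]]] that]
    by simp
  have I: "a / b \<in> quotient_values" if "a \<in> polynomial_values" "b \<in> polynomial_values" for a b
  proof (cases "b = 0")
    case True
    then show ?thesis
      using polynomial_values_subset_quotient_values polynomial_values_const[OF subfield_0[OF K]] by auto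
  qed (use that in \<open>auto simp: quotient_values_def\<close>)
  have E: "\<exists>a b. x = a / b \<and> a \<in> polynomial_values \<and> b \<in> polynomial_values \<and> b \<noteq> 0"
    if "x \<in> quotient_values" for x
    using that by (auto simp: quotient_values_def)
  show ?thesis
  proof (rule subfield_ambientI)
    show "1 \<in> quotient_values"
      using polynomial_values_subset_quotient_values polynomial_values_const[OF subfield_1[OF K]] by auto
    show "- x \<in> quotient_values" "inverse x \<in> quotient_values" if x: "x \<in> quotient_values" for x
    proof -
      obtain a b where ab: "x = a / b" "a \<in> polynomial_values" "b \<in> polynomial_values"
        using E[OF x] by blast
      show "- x \<in> quotient_values" "inverse x \<in> quotient_values"
        using I[OF neg[OF ab(2)] ab(3)] I[OF ab(3,2)] by (simp_all add: ab(1))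
    qed
    show "x * y \<in> quotient_values" "x + y \<in> quotient_values"
      if xy: "x \<in> quotient_values" "y \<in> quotient_values" for x y
    proof -
      obtain a b where ab: "x = a / b" "a \<in> polynomial_values" "b \<in> polynomial_values" "b \<noteq> 0"
        using E[OF xy(1)] by blast
      obtain c d where cd: "y = c / d" "c \<in> polynomial_values" "d \<in> polynomial_values" "d \<noteq> 0"
        using E[OF xy(2)] by blast
      have "x * y = (a * c) / (b * d)" "x + y = (a * d + c * b) / (b * d)"
        using ab cd by (simp_all add: add_frac_eq)
      then show "x * y \<in> quotient_values" "x + y \<in> quotient_values"
        using ab cd by (auto intro!: I polynomial_values_mult polynomial_values_add)
    qed
  qed
qed

lemma common_denominator:
  assumes "finite B" "B \<subseteq> quotient_values"
  shows "\<exists>Q\<in>polynomial_values. Q \<noteq> 0 \<and> (\<forall>b\<in>B. b * Q \<in> polynomial_values)"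
  using assms
proof (induction B rule: finite_induct)
  case empty
  then show ?case
    using polynomial_values_const[OF subfield_1[OF K]] by (intro bexI[of _ 1]) auto
next
  case (insert b B)
  then obtain Q where Q: "Q \<in> polynomial_values" "Q \<noteq> 0" "\<And>x. x \<in> B \<Longrightarrow> x * Q \<in> polynomial_values"
    by auto
  obtain c d where cd: "b = c / d" "c \<in> polynomial_values" "d \<in> polynomial_values" "d \<noteq> 0"
    using insert.prems unfolding quotient_values_def by blast
  have "x * (Q * d) \<in> polynomial_values" if "x \<in> insert b B" for x
  proof (cases "x = b")
    case True
    then have "x * (Q * d) = c * Q"
      using cd by simp
    then show ?thesis
      using polynomial_values_mult[OF cd(2) Q(1)] by (simp only:)
  next
    case False
    then have "(x * Q) * d \<in> polynomial_values"
      using that cd Q polynomial_values_mult by blast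
    then show ?thesis
      by (simp add: mult.assoc)
  qed
  then show ?case
    using Q cd polynomial_values_mult by (intro bexI[of _ "Q * d"]) auto
qed

lemma bounded_common_denominator:
  assumes "finite B" "B \<subseteq> quotient_values"
  shows "\<exists>d. \<exists>Q\<in>bounded_polys d. Q \<noteq> 0 \<and> (\<forall>b\<in>B. b * Q \<in> bounded_polys d)"
proof -
  obtain Q where Q: "Q \<in> polynomial_values" "Q \<noteq> 0" "\<And>x. x \<in> B \<Longrightarrow> x * Q \<in> polynomial_values"
    using common_denominator[OF assms] by blast
  have "\<exists>d. \<forall>x\<in>T. x \<in> bounded_polys d" if "finite T" "T \<subseteq> polynomial_values" for T
    using that
  proof (induction T rule: finite_induct)
    case (insert x T)
    then obtain d d' where "\<forall>y\<in>T. y \<in> bounded_polys d" "x \<in> bounded_polys d'"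
      by (auto simp: polynomial_values_def)
    then have "\<forall>y\<in>insert x T. y \<in> bounded_polys (max d d')"
      by (auto intro: bounded_polys_mono[of _ d] bounded_polys_mono[of _ d'])
    then show ?case
      by blast
  qed simp
  from this[of "insert Q ((\<lambda>b. b * Q) ` B)"] show ?thesis
    using assms(1) Q by auto
qed

text \<open>
  The monomials in \<open>B\<close> with exponents below \<open>D\<close> become, after clearing denominators, polynomials
  in \<open>g\<close> of degree \<open>O(D)\<close> in each variable, so if \<open>card B > N\<close> they are linearly dependent for
  large \<open>D\<close>.
\<close>

lemma card_alg_independent_le:
  assumes B: "finite B" "B \<subseteq> quotient_values" and indep: "alg_independent K B"
  shows "card B \<le> N"
proof (rule ccontr)
  assume "\<not> card B \<le> N"
  then have n: "Suc N \<le> card B"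
    by simp
  obtain d Q where Q: "Q \<in> bounded_polys d" "Q \<noteq> 0" and BQ: "\<And>b. b \<in> B \<Longrightarrow> b * Q \<in> bounded_polys d"
    using bounded_common_denominator[OF B] by blast
  \<comment> \<open>Chosen to exceed (card B * d + 1)^N. As M + 1 \<le> (card B * d + 1) D, it
    follows that (M+1)^N < D^(N+1) \<le> D^(card B), so there are more monomials in B than power
    products available.\<close>
  define D where "D = Suc (Suc (card B * d) ^ N)"
  define M where "M = card B * (D * d)"
  define I where "I = B \<rightarrow>\<^sub>E {..<D}"
  define val where "val e = (\<Prod>b\<in>B. b ^ e b)" for e :: "'a \<Rightarrow> nat"
  have finI: "finite I"
    using B by (simp add: I_def finite_PiE)
  have card: "card (exponent_box M) < card I"
  proof -
    have D1: "D \<ge> 1"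
      by (simp add: D_def)
    then have "Suc M \<le> Suc (card B * d) * D"
      using D1 by (simp add: M_def mult_ac)
    then have "Suc M ^ N \<le> (Suc (card B * d) * D) ^ N"
      by (rule power_mono) simp
    also have "\<dots> = Suc (card B * d) ^ N * D ^ N"
      by (rule power_mult_distrib)
    also have "\<dots> < D * D ^ N"
      by (rule mult_strict_right_mono) (simp_all add: D_def)
    also have "\<dots> = D ^ Suc N"
      by simp
    also have "\<dots> \<le> D ^ card B"
      by (rule power_increasing[OF n]) (simp add: D_def)
    finally show ?thesis
      using B by (simp add: card_exponent_box I_def card_PiE)
  qed
  \<comment> \<open>One factor Q^D goes to each b: Q^(e b) clears the denominator of b^(e b), and
    the rest is kept. The total power of Q is thus the same for all e and can be cancelled from a
    linear relation.\<close>
  have "val e * Q ^ (card B * D) \<in> bounded_polys M" if "e \<in> I" for e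
  proof -
    have e: "e b \<le> D" if "b \<in> B" for b
      using \<open>e \<in> I\<close> that by (auto simp: I_def PiE_iff less_imp_le)
    have "val e * Q ^ (card B * D) = (\<Prod>b\<in>B. b ^ e b * Q ^ D)"
      by (simp add: val_def prod.distrib power_mult mult.commute[of "card B"])
    also have "\<dots> = (\<Prod>b\<in>B. (b * Q) ^ e b * Q ^ (D - e b))"
    proof (rule prod.cong)
      fix b assume "b \<in> B"
      then have "Q ^ D = Q ^ e b * Q ^ (D - e b)"
        using e[of b] by (simp flip: power_add)
      then show "b ^ e b * Q ^ D = (b * Q) ^ e b * Q ^ (D - e b)"
        by (simp only: power_mult_distrib mult.assoc)
    qed simp
    also have "\<dots> \<in> bounded_polys M"
      unfolding M_def
    proof (rule bounded_polys_prod[OF B(1)])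
      fix b assume b: "b \<in> B"
      have "(b * Q) ^ e b * Q ^ (D - e b) \<in> bounded_polys (e b * d + (D - e b) * d)"
        by (intro bounded_polys_mult bounded_polys_power BQ b Q)
      then show "(b * Q) ^ e b * Q ^ (D - e b) \<in> bounded_polys (D * d)"
        using e[OF b] by (simp only: add_mult_distrib[symmetric] le_add_diff_inverse)
    qed
    finally show ?thesis .
  qed
  then have "\<forall>e\<in>I. \<exists>a. (\<forall>t\<in>exponent_box M. a t \<in> K) \<and>
      val e * Q ^ (card B * D) = (\<Sum>t\<in>exponent_box M. a t * power_product t)"
    unfolding bounded_polys_def by blast
  then obtain A where A: "\<And>e t. e \<in> I \<Longrightarrow> t \<in> exponent_box M \<Longrightarrow> A e t \<in> K"
    and A_eq: "\<And>e. e \<in> I \<Longrightarrow>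
      val e * Q ^ (card B * D) = (\<Sum>t\<in>exponent_box M. A e t * power_product t)"
    by metis
  \<comment> \<open>One equation for each power product in g and one unknown for each monomial in B.
    The power products need not be independent: it suffices that all their coefficients
    cancel.\<close>
  have "\<exists>c. (\<forall>e\<in>I. c e \<in> K) \<and> (\<exists>e\<in>I. c e \<noteq> 0) \<and>
      (\<forall>t\<in>exponent_box M. (\<Sum>e\<in>I. A e t * c e) = 0)"
    by (rule homogeneous_system_nontrivial_solution[OF K finite_exponent_box finI card]) (rule A)
  then obtain c where c: "\<And>e. e \<in> I \<Longrightarrow> c e \<in> K" "\<exists>e\<in>I. c e \<noteq> 0"
    and c_eq: "\<And>t. t \<in> exponent_box M \<Longrightarrow> (\<Sum>e\<in>I. A e t * c e) = 0"
    by blast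
  have "(\<Sum>e\<in>I. c e * val e) * Q ^ (card B * D) =
      (\<Sum>e\<in>I. c e * (\<Sum>t\<in>exponent_box M. A e t * power_product t))"
    by (simp add: sum_distrib_right mult.assoc A_eq)
  also have "\<dots> = (\<Sum>t\<in>exponent_box M. (\<Sum>e\<in>I. A e t * c e) * power_product t)"
    unfolding sum_distrib_left sum_distrib_right
    by (subst sum.swap) (simp only: mult.assoc mult.left_commute)
  also have "\<dots> = 0"
    by (simp add: c_eq)
  finally have val0: "(\<Sum>e\<in>I. c e * val e) = 0"
    using Q by simp
  define t where "t e = (\<Sum>b\<in>B. Poly_Mapping.single b (e b))" for e :: "'a \<Rightarrow> nat"
  define P where "P = (\<Sum>e\<in>I. Poly_Mapping.single (t e) (c e))"
  have lookup_t: "Poly_Mapping.lookup (t e) b = (if b \<in> B then e b else 0)" for e b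
    using B(1) by (simp add: t_def lookup_sum lookup_single when_def sum.delta)
  have keys_t: "Poly_Mapping.keys (t e) \<subseteq> B" for e
    by (auto simp: in_keys_iff lookup_t split: if_splits)
  \<comment> \<open>Distinct exponent vectors give distinct monomials, so the coefficients of P are
    the \<open>c e\<close> themselves and P is nonzero although it vanishes at B.\<close>
  have t_inj: "inj_on t I"
  proof (rule inj_onI)
    fix e e' assume e: "e \<in> I" "e' \<in> I" "t e = t e'"
    have "e b = e' b" if "b \<in> B" for b
      using lookup_t[of e b] lookup_t[of e' b] e(3) that by simp
    with e(1,2) show "e = e'"
      unfolding I_def by (intro PiE_ext)
  qed
  have lookup_P: "Poly_Mapping.lookup P s = (\<Sum>e\<in>I. if t e = s then c e else 0)" for s
    by (simp add: P_def lookup_sum lookup_single when_def)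
  have "Poly_Mapping.lookup P s \<in> K" for s
    unfolding lookup_P using c(1) subfield_0[OF K] by (intro subfield_sum[OF K]) auto
  moreover have "Poly_Mapping.keys s \<subseteq> B" if "s \<in> Poly_Mapping.keys P" for s
  proof -
    have "\<exists>e\<in>I. t e = s"
    proof (rule ccontr)
      assume "\<not> ?thesis"
      then have "Poly_Mapping.lookup P s = 0"
        unfolding lookup_P by (intro sum.neutral) auto
      then show False
        using that by (simp add: in_keys_iff)
    qed
    then show ?thesis
      using keys_t by blast
  qed
  moreover have "poly_eval (\<lambda>c. c) (\<lambda>b. b) P = 0"
  proof -
    have "monomial_value (\<lambda>b. b) (t e) = val e" for e
      unfolding val_def by (subst monomial_value_superset[OF B(1) keys_t]) (simp add: lookup_t)
    then show ?thesis
      using val0 by (simp add: P_def poly_eval_sum poly_eval_single)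
  qed
  ultimately have "P = 0"
    using spec[OF indep[unfolded alg_independent_def], of P] by blast
  moreover have "Poly_Mapping.lookup P (t e) = c e" if "e \<in> I" for e
  proof -
    have "Poly_Mapping.lookup P (t e) = (\<Sum>e'\<in>I. if e' = e then c e' else 0)"
      unfolding lookup_P using that inj_onD[OF t_inj] by (intro sum.cong) auto
    also have "\<dots> = c e"
      using that finI by simp
    finally show ?thesis .
  qed
  ultimately show False
    using c(2) by auto
qed

lemma trdeg_quotient_values: "trdeg K quotient_values \<le> enat N"
  unfolding trdeg_def by (rule SUP_least) (auto intro: card_alg_independent_le)

end

lemma finitely_generated_subfield:
  fixes k F :: "'a::field set"
  assumes k: "subfield k ambient" and F: "subfield F ambient" and kF: "k \<subseteq> F"
    and S: "finite S" "S \<subseteq> F" "card S \<le> N"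
  shows "\<exists>E. subfield E ambient \<and> k \<subseteq> E \<and> E \<subseteq> F \<and> S \<subseteq> E \<and> trdeg k E \<le> enat N"
proof -
  obtain g where g: "S = g ` {..<card S}"
    using ex_bij_betw_nat_finite[OF S(1)] by (auto simp: bij_betw_def lessThan_atLeast0)
  let ?E = "quotient_values k g (card S)"
  have "polynomial_values k g (card S) \<subseteq> ?E"
    by (rule polynomial_values_subset_quotient_values[OF k])
  moreover have "k \<subseteq> polynomial_values k g (card S)"
    by (intro subsetI polynomial_values_const[OF k])
  moreover have "g ` {..<card S} \<subseteq> polynomial_values k g (card S)"
    by (intro image_subsetI polynomial_values_generator[OF k]) simp
  ultimately have "k \<subseteq> ?E" "S \<subseteq> ?E"
    using g by simp_all
  moreover have "?E \<subseteq> F"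
    using g S(2) by (intro quotient_values_subset[OF k F kF]) auto
  moreover have "trdeg k ?E \<le> enat N"
    using S(3) by (intro order_trans[OF trdeg_quotient_values[OF k]]) simp
  ultimately show ?thesis
    using subfield_quotient_values[OF k] by blast
qed

theorem proposition6p5:
  fixes p m n l :: nat
    and k F :: "'a::field set"
    and \<sigma> :: "nat \<Rightarrow> ('a list \<times> 'a list \<Rightarrow>\<^sub>0 int) set set"
    and \<pi> :: "('a list \<times> 'a list \<Rightarrow>\<^sub>0 int) set set"
  assumes "Factorial_Ring.prime p"
    and "m > 0" and "n > 0" and "l > 0"
    and "subfield F ambient"
    and "subfield k ambient" and "k \<subseteq> F"
    and "CHAR('a) = p"
    and "infinite k \<or> p ^ l \<le> card k"
    and "\<And>i. i < l \<Longrightarrow> \<sigma> i \<in> km_symbols p m n F"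
    and "\<pi> = finprod (kato_milne p m n F) \<sigma> {..<l}"
  shows "km_ed p m n k F \<pi> \<le> enat (m + l * n)"
proof -
  note p = assms(1) and F = assms(5) and k = assms(6) and kF = assms(7)
  let ?W = "witt_group p m F"
  have "\<exists>\<omega> bs. \<sigma> i = km_symbol p m n F \<omega> bs \<and> \<omega> \<in> carrier ?W \<and>
      length bs = n \<and> set bs \<subseteq> carrier (unit_group F)" if "i < l" for i
    using assms(10)[OF that] unfolding km_symbols_def carrier_witt_ring[OF p F] mem_Collect_eq .
  then obtain \<omega> bs where symbols: "\<And>i. i < l \<Longrightarrow> \<sigma> i = km_symbol p m n F (\<omega> i) (bs i) \<and>
      \<omega> i \<in> carrier ?W \<and> length (bs i) = n \<and> set (bs i) \<subseteq> carrier (unit_group F)"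
    by metis
  then have \<sigma>: "\<And>i. i < l \<Longrightarrow> \<sigma> i = km_symbol p m n F (\<omega> i) (bs i)"
    and \<omega>: "\<And>i. i < l \<Longrightarrow> \<omega> i \<in> carrier ?W"
    and bs: "\<And>i. i < l \<Longrightarrow> length (bs i) = n" "\<And>i. i < l \<Longrightarrow> set (bs i) \<subseteq> carrier (unit_group F)"
    by blast+
  have \<omega>_nth: "length (\<omega> i) = m" "\<And>j. j < m \<Longrightarrow> \<omega> i ! j \<in> F" if "i < l" for i
    using \<omega>[OF that] nth_mem[of _ "\<omega> i"] by (auto simp: witt_group_simps[OF F])
  obtain v \<theta> x where v: "\<And>i. i < l \<Longrightarrow> v i \<in> k" and \<theta>: "\<And>j. j < m \<Longrightarrow> \<theta> j \<in> F"
    and x: "\<And>i j. i < l \<Longrightarrow> j < m \<Longrightarrow> x i j \<in> F"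
    and eq: "\<And>i j. i < l \<Longrightarrow> j < m \<Longrightarrow> witt_add p ((!) (\<omega> i)) (x i) j =
      witt_add p (\<lambda>j. v i ^ (p ^ j) * \<theta> j) (\<lambda>j. x i j ^ p) j"
    using simultaneous_witt_reduction[OF p assms(8) F k kF assms(9), of m "\<lambda>i. (!) (\<omega> i)", OF \<omega>_nth(2)]
    by blast
  define \<omega>' where "\<omega>' i = map (\<lambda>j. v i ^ (p ^ j) * \<theta> j) [0..<m]" for i
  define y where "y i = map (x i) [0..<m]" for i
  \<comment> \<open>The \<open>v i\<close> already lie in k, so all l Witt vectors together
    contribute only the m components of \<theta>; this is the m in the bound, and the units give l
    n.\<close>
  define S where "S = \<theta> ` {..<m} \<union> (\<Union>i<l. set (bs i))"
  have "finite S"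
    by (simp add: S_def)
  moreover have "S \<subseteq> F"
    using \<theta> bs(2) by (auto simp: S_def carrier_unit_group[OF F])
  moreover have "card S \<le> m + l * n"
  proof -
    have "card (\<theta> ` {..<m}) \<le> m"
      using card_image_le[of "{..<m}" \<theta>] by simp
    moreover have "card (\<Union>i<l. set (bs i)) \<le> (\<Sum>i<l. card (set (bs i)))"
      by (rule card_UN_le) simp
    moreover have "(\<Sum>i<l. card (set (bs i))) \<le> (\<Sum>i<l. n)"
      by (rule sum_mono) (use bs(1) card_length in \<open>metis lessThan_iff\<close>)
    ultimately show ?thesis
      unfolding S_def using card_Un_le[of "\<theta> ` {..<m}" "\<Union>i<l. set (bs i)"] by simp
  qed
  ultimately obtain E where E: "subfield E ambient" and kE: "k \<subseteq> E" and EF: "E \<subseteq> F" and SE: "S \<subseteq> E"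
    and trdeg: "trdeg k E \<le> enat (m + l * n)"
    using finitely_generated_subfield[OF k F kF] by blast
  have \<omega>'_E: "\<omega>' i \<in> carrier (witt_group p m E)" if "i < l" for i
  proof -
    have "v i ^ (p ^ j) * \<theta> j \<in> E" if "j < m" for j
      using v[OF \<open>i < l\<close>] kE SE that
      by (intro subfield_mult[OF E] subfield_power[OF E]) (auto simp: S_def)
    then show ?thesis
      by (auto simp: \<omega>'_def witt_group_simps[OF E])
  qed
  have bs_E: "set (bs i) \<subseteq> carrier (unit_group E)" if "i < l" for i
    using bs(2)[OF that] SE that by (auto simp: S_def carrier_unit_group[OF E] carrier_unit_group[OF F])
  \<comment> \<open>The symbols are compared over F, because \<open>y i\<close> is only known to lie
    over F; after this change all their entries lie in E.\<close>
  have \<sigma>': "\<sigma> i = km_symbol p m n F (\<omega>' i) (bs i)" if i: "i < l" for i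
    unfolding \<sigma>[OF i]
  proof (rule km_symbol_cong[OF p F \<omega>[OF i] _ _ bs(1)[OF i] bs(2)[OF i]])
    show "\<omega>' i \<in> carrier ?W"
      using \<omega>'_E[OF i] carrier_witt_group_mono[OF p E F EF] by blast
    show "y i \<in> carrier ?W"
      using x[OF i] by (auto simp: y_def witt_group_simps[OF F])
    show "\<omega> i \<otimes>\<^bsub>?W\<^esub> y i = \<omega>' i \<otimes>\<^bsub>?W\<^esub> witt_pow p (y i)"
      unfolding witt_group_simps[OF F]
    proof (rule nth_equalityI)
      fix j assume "j < length (witt_op m (witt_sum_poly p) (\<omega> i) (y i))"
      then have j: "j < m"
        by simp
      have "witt_add p ((!) (\<omega> i)) ((!) (y i)) j = witt_add p ((!) (\<omega> i)) (x i) j"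
        by (rule witt_add_cong[OF p]) (use j in \<open>auto simp: y_def\<close>)
      also have "\<dots> = witt_add p ((!) (\<omega>' i)) ((!) (witt_pow p (y i))) j"
        unfolding eq[OF i j]
        by (rule witt_add_cong[OF p]) (use j in \<open>auto simp: y_def \<omega>'_def witt_pow_def\<close>)
      finally show "witt_op m (witt_sum_poly p) (\<omega> i) (y i) ! j =
          witt_op m (witt_sum_poly p) (\<omega>' i) (witt_pow p (y i)) ! j"
        using j by (simp add: nth_witt_op_sum)
    qed simp
  qed
  interpret KM: comm_group "kato_milne p m n F"
    by (rule comm_group_kato_milne[OF p F])
  have "\<exists>z\<in>carrier (kato_milne p m n E). km_res p m n F z =
      finprod (kato_milne p m n F) (\<lambda>i. km_symbol p m n F (\<omega>' i) (bs i)) {..<l}"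
    by (rule km_res_finprod_symbols[OF p E F EF]) (intro conjI \<omega>'_E bs bs_E)
  moreover have "\<pi> = finprod (kato_milne p m n F) (\<lambda>i. km_symbol p m n F (\<omega>' i) (bs i)) {..<l}"
    unfolding assms(11)
  proof (rule KM.finprod_cong')
    show "(\<lambda>i. km_symbol p m n F (\<omega>' i) (bs i)) \<in> {..<l} \<rightarrow> carrier (kato_milne p m n F)"
      using \<sigma> \<sigma>' km_symbol_closed[OF p F \<omega> bs] by (auto simp: Pi_iff)
  qed (use \<sigma>' in auto)
  ultimately have "km_ed p m n k F \<pi> \<le> trdeg k E"
    unfolding km_ed_def essential_dimension_def
    by (intro INF_lower) (use E kE EF in auto)
  with trdeg show ?thesis
    by (rule order_trans[rotated])
qed

end
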